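(* Let $\dot x=f(x,w)$, $r=g(x,w)$ be an exposed system with linearization $G$ about $(x,w)=(0,0)$, where $G$ is asymptotically stable, and let $\Delta$ be an $H_\infty$ minimal destabilizing feedback attack on $G$ (all under the standing assumptions listed in the context). For $\epsilon>0$ put $\Delta_\epsilon:=(1+\epsilon)\Delta$. Then, for all sufficiently small $\epsilon>0$, the feedback interconnection between $G$ and $\Delta_\epsilon$ is well-posed and internally unstable. Consequently, for all sufficiently small $\epsilon>0$, the feedback interconnection of the exposed system with $\Delta_\epsilon$ is well-posed and has the origin $(x,\tilde x)=(0,0)$ as an unstable equilibrium point.
   Context: **Exposed system.** $\dot x=f(x,w)$, $r=g(x,w)$ with state $x(t)\in\mathbb{R}^n$, adversarial input $w(t)\in\mathbb{R}^m$ and output $r(t)\in\mathbb{R}^p$ visible to the adversary. Standing assumptions: $f(0,0)=0$, $g(0,0)=0$; $f$ is $C^1$ in a neighborhood of $(0,0)$; $g$ is $C^1$; the origin is an asymptotically stable equilibrium of $\dot x=f(x,0)$; and $\dot x=f(x,w)$, $x(0)=x_0$, admits a unique bounded solution for all time whenever $x_0$ and $w(t)$ are small enough. **Linearization.** $G$ is the LTI system $\dot x=Ax+Bw$, $r=Cx+Dw$, where $A=\partial_x f(0,0)$, $B=\partial_w f(0,0)$, $C=\partial_x g(0,0)$, $D=\partial_w g(0,0)$. Its transfer function is $G(s)=C(sI-A)^{-1}B+D$, of size $p\times m$. It is assumed that all eigenvalues of $A$ have negative real part (this is asymptotic stability of $G$) and that $G(s)$ is not identically zero. **Attack.** $\Delta$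 is the LTI system $\dot{\tilde x}=\tilde A\tilde x+\tilde B r$, $w=\tilde C\tilde x+\tilde D r$ with real matrices, where all eigenvalues of $\tilde A$ have negative real part ("stable"), and with $m\times p$ transfer function $\Delta(s)=\tilde C(sI-\tilde A)^{-1}\tilde B+\tilde D$. The system $\Delta_\epsilon=(1+\epsilon)\Delta$ is obtained by replacing $\tilde C,\tilde D$ with $(1+\epsilon)\tilde C,(1+\epsilon)\tilde D$. **$H_\infty$ norm.** For a stable LTI system $H$ with transfer function $H(s)$, $\|H\|_{H_\infty}=\sup_{\operatorname{Re}s\ge0}\|H(s)\|_2=\sup_{\omega\in\mathbb{R}}\|H(j\omega)\|_2$, where $\|\cdot\|_2$ is the spectral norm and $j$ is the imaginary unit. **Minimal destabilizing feedback attack.** A minimal destabilizing feedback attack on $G$ (also called $H_\infty$ minimal) is a stable LTI system $\Delta$ such that (i) $\det(I-\Delta(j\omega_0)G(j\omega_0))=0$ for some $\omega_0\in\mathbb{R}$, and (ii) $\|\Delta\|_{H_\infty}=1/\|G\|_{H_\infty}$. **Linear interconnection.** The feedback interconnection of $G$ and $\Delta$ is obtained by identifying the signals $r$ and $w$ in the two systems. It is well-posed if $\det(I-\tilde DD)\neq0$, and then $w=(I-\tilde DD)^{-1}(\tilde Dr_0+\tilde C\tilde x)$ with $r_0=Cx$, and the closed loop is a linear ODE in $(x,\tilde x)$; when $D=0$ its matrix is $\begin{bmatrix}A+B\tilde DC & B\tilde C\\ \tilde BC&\tilde A\end{bmatrix}$. The interconnection is internally stable if this closed-loop linear ODE is asymptotically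 stable, and internally unstable otherwise. **Nonlinear interconnection.** The feedback interconnection of the exposed system with $\Delta$ is $\dot x=f(x,w)$, $\dot{\tilde x}=\tilde A\tilde x+\tilde B\,r$, with $r=g(x,w)$ and $w=\tilde C\tilde x+\tilde D\,r$. It is well-posed if $I-\tilde D\frac{\partial g}{\partial w}(x,w)$ is invertible for all $(x,w)$ and the relation $w=\tilde C\tilde x+\tilde Dg(x,w)$ determines $w$ uniquely as a function of $(x,\tilde x)$. The interconnections with $\Delta_\epsilon$ are defined in the same way, with $\tilde C,\tilde D$ replaced by $(1+\epsilon)\tilde C,(1+\epsilon)\tilde D$. **Standing well-posedness assumptions.** $\det(I-\tilde DD)=\det(I-\Delta(\infty)G(\infty))\ne0$; moreover either $\sup_{x,w}\|\tilde D\frac{\partial g}{\partial w}(x,w)\|_2<1$ or $\tilde D=0$. **Stability of equilibria.** An equilibrium $x_e$ of $\dot x=F(x)$ is Lyapunov stable if for every $\eta>0$ there is $\delta>0$ such that $|x(0)-x_e|<\delta$ implies $|x(t)-x_e|<\eta$ for all $t\ge0$. It is asymptotically stable if it is Lyapunov stable and there is $\delta>0$ such that $|x(0)-x_e|<\delta$ implies $x(t)\to x_e$ as $t\to\infty$. It is unstable if it is not Lyapunov stable. *)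

theory Defs
  imports "HOL-Analysis.Analysis"
begin

section \<open>Ordinary differential equations and stability of equilibria\<close>

definition solves_ode ::
  "(real \<Rightarrow> 'a::real_normed_vector \<Rightarrow> 'a) \<Rightarrow> (real \<Rightarrow> 'a) \<Rightarrow> real set \<Rightarrow> bool" where
  "solves_ode F x I \<longleftrightarrow> (\<forall>t\<in>I. (x has_vector_derivative F t (x t)) (at t within I))"

definition equilibrium :: "('a::real_normed_vector \<Rightarrow> 'a) \<Rightarrow> 'a \<Rightarrow> bool" where
  "equilibrium F xe \<longleftrightarrow> F xe = 0"

text \<open>Solutions on bounded intervals \<open>{0..T}\<close> are included, so that a solution which leaves the
  \<open>\<eta>\<close>-ball and then blows up in finite time violates stability. Existence of global
  solutions is not demanded separately: if \<open>F\<close> is continuous near \<open>xe\<close> in a finite-dimensional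
  space, solutions that stay in a small closed ball around \<open>xe\<close> extend to all \<open>t \<ge> 0\<close>.\<close>

definition lyapunov_stable :: "('a::real_normed_vector \<Rightarrow> 'a) \<Rightarrow> 'a \<Rightarrow> bool" where
  "lyapunov_stable F xe \<longleftrightarrow>
     (\<forall>\<eta>>0. \<exists>\<delta>>0. \<forall>x T. solves_ode (\<lambda>_. F) x {0..T} \<and> norm (x 0 - xe) < \<delta> \<longrightarrow>
        (\<forall>t\<in>{0..T}. norm (x t - xe) < \<eta>))"

definition asymptotically_stable :: "('a::real_normed_vector \<Rightarrow> 'a) \<Rightarrow> 'a \<Rightarrow> bool" where
  "asymptotically_stable F xe \<longleftrightarrow>
     lyapunov_stable F xe \<and>
     (\<exists>\<delta>>0. \<forall>x. solves_ode (\<lambda>_. F) x {0..} \<and> norm (x 0 - xe) < \<delta> \<longrightarrow> (x \<longlongrightarrow> xe) at_top)"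

definition unstable_equilibrium :: "('a::real_normed_vector \<Rightarrow> 'a) \<Rightarrow> 'a \<Rightarrow> bool" where
  "unstable_equilibrium F xe \<longleftrightarrow> equilibrium F xe \<and> \<not> lyapunov_stable F xe"


section \<open>LTI systems\<close>

text \<open>The type parameters index the state, the input and the output, in this order.\<close>

record ('n::finite, 'm::finite, 'p::finite) lti =
  lti_A :: "real^'n^'n"
  lti_B :: "real^'m^'n"
  lti_C :: "real^'n^'p"
  lti_D :: "real^'m^'p"

definition cmat :: "real^'b^'a \<Rightarrow> complex^'b^'a" where
  "cmat M = map_matrix complex_of_real M"

definition stable_lti :: "('n::finite, 'm::finite, 'p::finite) lti \<Rightarrow> bool" where
  "stable_lti H \<longleftrightarrow>
     (\<forall>(z::complex) v. v \<noteq> 0 \<and> cmat (lti_A H) *v v = z *s v \<longrightarrow> Re z < 0)"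

text \<open>Meaningful only where \<open>s\<close> is not an eigenvalue of the state matrix.\<close>

definition transfer :: "('n::finite, 'm::finite, 'p::finite) lti \<Rightarrow> complex \<Rightarrow> complex^'m^'p" where
  "transfer H s =
     cmat (lti_C H) ** matrix_inv (mat s - cmat (lti_A H)) ** cmat (lti_B H) + cmat (lti_D H)"

definition transfer_nonzero :: "('n::finite, 'm::finite, 'p::finite) lti \<Rightarrow> bool" where
  "transfer_nonzero H \<longleftrightarrow> (\<exists>s. invertible (mat s - cmat (lti_A H)) \<and> transfer H s \<noteq> 0)"

text \<open>\<^term>\<open>onorm\<close> with respect to the Euclidean norms.\<close>

definition spectral_norm :: "'a::real_normed_field^'m^'p \<Rightarrow> real" where
  "spectral_norm M = onorm (\<lambda>v. M *v v)"

text \<open>For a stable system the supremum is over a bounded set, so the real-valued supremum is the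
  intended one.\<close>

definition hinf_norm :: "('n::finite, 'm::finite, 'p::finite) lti \<Rightarrow> real" where
  "hinf_norm H = (SUP s\<in>{s. Re s \<ge> 0}. spectral_norm (transfer H s))"

definition scale_lti ::
  "real \<Rightarrow> ('n::finite, 'm::finite, 'p::finite) lti \<Rightarrow> ('n, 'm, 'p) lti" where
  "scale_lti c H = H\<lparr>lti_C := c *\<^sub>R lti_C H, lti_D := c *\<^sub>R lti_D H\<rparr>"

definition minimal_destabilizing_attack ::
  "('n::finite, 'm::finite, 'p::finite) lti \<Rightarrow> ('k::finite, 'p, 'm) lti \<Rightarrow> bool" where
  "minimal_destabilizing_attack G \<Delta> \<longleftrightarrow>
     stable_lti \<Delta> \<and>
     (\<exists>\<omega>\<^sub>0::real. det (mat 1 - transfer \<Delta> (\<i> * of_real \<omega>\<^sub>0) ** transfer G (\<i> * of_real \<omega>\<^sub>0)) = 0) \<and>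
     hinf_norm \<Delta> = 1 / hinf_norm G"


section \<open>Linear feedback interconnection\<close>

definition lin_well_posed ::
  "('n::finite, 'm::finite, 'p::finite) lti \<Rightarrow> ('k::finite, 'p, 'm) lti \<Rightarrow> bool" where
  "lin_well_posed G \<Delta> \<longleftrightarrow> det (mat 1 - lti_D \<Delta> ** lti_D G) \<noteq> 0"

definition lin_closed_loop ::
  "('n::finite, 'm::finite, 'p::finite) lti \<Rightarrow> ('k::finite, 'p, 'm) lti \<Rightarrow>
     (real^'n) \<times> (real^'k) \<Rightarrow> (real^'n) \<times> (real^'k)" where
  "lin_closed_loop G \<Delta> = (\<lambda>(x, y).
     let w = matrix_inv (mat 1 - lti_D \<Delta> ** lti_D G) *v
               (lti_D \<Delta> *v (lti_C G *v x) + lti_C \<Delta> *v y);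
         r = lti_C G *v x + lti_D G *v w
     in (lti_A G *v x + lti_B G *v w, lti_A \<Delta> *v y + lti_B \<Delta> *v r))"

definition internally_stable ::
  "('n::finite, 'm::finite, 'p::finite) lti \<Rightarrow> ('k::finite, 'p, 'm) lti \<Rightarrow> bool" where
  "internally_stable G \<Delta> \<longleftrightarrow> asymptotically_stable (lin_closed_loop G \<Delta>) 0"


section \<open>The exposed system and its linearization\<close>

definition C1_on :: "('a::real_normed_vector \<Rightarrow> 'b::real_normed_vector) \<Rightarrow> 'a set \<Rightarrow> bool" where
  "C1_on h U \<longleftrightarrow>
     (\<exists>h'. (\<forall>z\<in>U. (h has_derivative blinfun_apply (h' z)) (at z)) \<and> continuous_on U h')"

definition jac_x :: "((real^'n) \<times> (real^'m) \<Rightarrow> real^'q) \<Rightarrow> real^'n \<Rightarrow> real^'m \<Rightarrow> real^'n^'q" where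
  "jac_x h x w = jacobian (\<lambda>x. h (x, w)) (at x)"

definition jac_w :: "((real^'n) \<times> (real^'m) \<Rightarrow> real^'q) \<Rightarrow> real^'n \<Rightarrow> real^'m \<Rightarrow> real^'m^'q" where
  "jac_w h x w = jacobian (\<lambda>w. h (x, w)) (at w)"

definition exposed_system ::
  "((real^'n) \<times> (real^'m) \<Rightarrow> real^'n) \<Rightarrow> ((real^'n) \<times> (real^'m) \<Rightarrow> real^'p) \<Rightarrow> bool" where
  "exposed_system f g \<longleftrightarrow>
     f (0, 0) = 0 \<and> g (0, 0) = 0 \<and>
     (\<exists>U. open U \<and> (0, 0) \<in> U \<and> C1_on f U) \<and>
     C1_on g UNIV \<and>
     asymptotically_stable (\<lambda>x. f (x, 0)) 0 \<and>
     (\<exists>\<delta>>0. \<forall>x0 w. norm x0 < \<delta> \<and> continuous_on {0..} w \<and> (\<forall>t\<ge>0. norm (w t) < \<delta>) \<longrightarrow>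
        (let sol = (\<lambda>x. x 0 = x0 \<and> solves_ode (\<lambda>t x. f (x, w t)) x {0..} \<and> bounded (x ` {0..}))
         in (\<exists>x. sol x) \<and> (\<forall>x y. sol x \<and> sol y \<longrightarrow> (\<forall>t\<ge>0. x t = y t))))"

definition linearization ::
  "((real^'n) \<times> (real^'m) \<Rightarrow> real^'n) \<Rightarrow> ((real^'n) \<times> (real^'m) \<Rightarrow> real^'p) \<Rightarrow> ('n, 'm, 'p) lti" where
  "linearization f g =
     \<lparr>lti_A = jac_x f 0 0, lti_B = jac_w f 0 0, lti_C = jac_x g 0 0, lti_D = jac_w g 0 0\<rparr>"


section \<open>Nonlinear feedback interconnection\<close>

definition nl_well_posed ::
  "((real^'n) \<times> (real^'m) \<Rightarrow> real^'p) \<Rightarrow> ('k::finite, 'p, 'm) lti \<Rightarrow> bool" where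
  "nl_well_posed g \<Delta> \<longleftrightarrow>
     (\<forall>x w. invertible (mat 1 - lti_D \<Delta> ** jac_w g x w)) \<and>
     (\<forall>x y. \<exists>!w. w = lti_C \<Delta> *v y + lti_D \<Delta> *v g (x, w))"

text \<open>Meaningful only for well-posed interconnections.\<close>

definition nl_closed_loop ::
  "((real^'n) \<times> (real^'m) \<Rightarrow> real^'n) \<Rightarrow> ((real^'n) \<times> (real^'m) \<Rightarrow> real^'p) \<Rightarrow> ('k::finite, 'p, 'm) lti \<Rightarrow>
     (real^'n) \<times> (real^'k) \<Rightarrow> (real^'n) \<times> (real^'k)" where
  "nl_closed_loop f g \<Delta> = (\<lambda>(x, y).
     let w = (THE w. w = lti_C \<Delta> *v y + lti_D \<Delta> *v g (x, w))
     in (f (x, w), lti_A \<Delta> *v y + lti_B \<Delta> *v g (x, w)))"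

text \<open>The supremum is taken in the extended reals, so that being less than 1 includes boundedness.\<close>

definition standing_well_posedness ::
  "((real^'n) \<times> (real^'m) \<Rightarrow> real^'n) \<Rightarrow> ((real^'n) \<times> (real^'m) \<Rightarrow> real^'p) \<Rightarrow> ('k::finite, 'p, 'm) lti \<Rightarrow>
     bool" where
  "standing_well_posedness f g \<Delta> \<longleftrightarrow>
     det (mat 1 - lti_D \<Delta> ** lti_D (linearization f g)) \<noteq> 0 \<and>
     ((SUP (x, w)\<in>UNIV. ereal (spectral_norm (lti_D \<Delta> ** jac_w g x w))) < 1 \<or> lti_D \<Delta> = 0)"

end

theory Submission
  imports Defs "HOL-Complex_Analysis.Complex_Analysis" "HOL-Computational_Algebra.Polynomial"
begin

text \<open>Close the loop of \<open>G\<close> with \<open>k \<Delta>\<close> for a complex gain \<open>k\<close>. The exponents \<open>s\<close> of the modes of this loop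
  are the zeros of a determinant \<open>F(s, k)\<close> whose entries are affine in \<open>s\<close> and \<open>k\<close>, hence of a polynomial
  in both variables (\<open>characteristic_bipolynomial_of_loop\<close>). Since the gains of \<open>\<Delta>\<close> and \<open>G\<close> multiply to at most 1,
  the small-gain argument excludes zeros with \<open>Re s \<ge> 0\<close> whenever \<open>|k| < 1\<close> (\<open>small_gain\<close>), while at \<open>k = 1\<close>
  there is the zero \<open>s\<^sub>0 = \<i> \<omega>\<^sub>0\<close> on the imaginary axis. The point is that for real \<open>k\<close> slightly above 1
  some zero lies strictly to the right of the axis (\<open>root_crosses_imaginary_axis\<close>).

  The zeros near \<open>s\<^sub>0\<close> may collide and are then only Puiseux branches in \<open>k\<close>, so they are not followed one
  by one. Their sum relative to \<open>s\<^sub>0\<close>, counted with multiplicity, is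
  \<open>Q(k) = 1/(2 \<pi> \<i>) \<integral> (s - s\<^sub>0) (\<partial>\<^sub>s F / F)(s, k) ds\<close> over a small circle about \<open>s\<^sub>0\<close>, which is holomorphic near
  \<open>k = 1\<close>. It vanishes at 1, and \<open>Re Q < 0\<close> inside the unit disc, which near 1 looks like a half-plane.
  A zero of order at least 2 would spread that half-plane over all directions, so the zero is simple, and its
  derivative must be positive. Hence \<open>Re Q(1 + \<epsilon>) > 0\<close>, and one of the summed zeros has positive real part.

  For the nonlinear loop, the standing assumption makes \<open>w \<mapsto> C' y + D' g(x, w)\<close> a contraction, so \<open>w\<close> is a
  function of the state that is Lipschitz near the origin and differentiable there. The loop vector field
  inherits this, and its derivative is the linear loop (\<open>nonlinear_loop_regular\<close>). An exponentially growing
  mode of the derivative forces instability (\<open>linearized_instability\<close>), and this covers the linear loop too. The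
  proof avoids a splitting of the state space into stable and unstable parts: if \<open>\<beta> > 0\<close> is below the growth rate and
  \<open>2 \<beta>\<close> is not an eigenvalue of \<open>X \<mapsto> M\<^sup>T X + X M\<close>, then \<open>M\<^sup>T X + X M = 2 \<beta> X + I\<close> has a
  solution, and its quadratic form is a Chetaev function: positive at some point, and growing at least like
  \<open>exp (2 \<beta> t)\<close> along solutions near the origin. Since Lyapunov stability speaks about solutions, refuting it
  needs solutions to exist. They come from a contraction argument in an exponentially weighted sup norm.\<close>

section \<open>Zeros of a bivariate polynomial crossing the imaginary axis\<close>

text \<open>Write \<open>Q(w) = (w - 1)^n g(w)\<close> with \<open>g(1) \<noteq> 0\<close>. Approaching 1 from inside the disc along the ray in direction
  \<open>- cis \<phi>\<close>, with \<open>|\<phi>| < \<pi>/2\<close>, gives \<open>Re (c cis (n \<phi>)) \<le> 0\<close> for \<open>c = (-1)^n g(1)\<close>. If \<open>n \<ge> 2\<close>, the angle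
  \<open>n \<phi>\<close> reaches every point of the interval \<open>(-\<pi>, \<pi>)\<close> and \<open>c\<close> would vanish. So \<open>n = 1\<close>, and \<open>Q'(1) = g(1)\<close> has
  positive real part.\<close>

lemma Re_pos_beyond_boundary_zero:
  assumes hol: "Q holomorphic_on ball 1 \<rho>" and \<rho>: "0 < \<rho>" and Q1: "Q 1 = 0"
    and neg: "\<And>k. k \<in> ball 1 \<rho> \<Longrightarrow> norm k < 1 \<Longrightarrow> Re (Q k) < 0"
  shows "\<forall>\<^sub>F \<epsilon> in at_right (0::real). 0 < Re (Q (1 + of_real \<epsilon>))"
proof -
  define k0 where "k0 = complex_of_real (1 - min \<rho> 1 / 2)"
  have "1 - k0 = of_real (min \<rho> 1 / 2)" unfolding k0_def of_real_diff of_real_1 by simp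
  then have "norm (1 - k0) = min \<rho> 1 / 2" using \<rho> by (simp only: norm_of_real)
  moreover have "norm k0 = 1 - min \<rho> 1 / 2"
    unfolding k0_def norm_of_real using \<rho> by (auto simp: min_def)
  ultimately have k0: "k0 \<in> ball 1 \<rho>" "norm k0 < 1" using \<rho> by (auto simp: dist_norm)
  have nonconst: "\<not> Q constant_on ball 1 \<rho>"
  proof
    assume "Q constant_on ball 1 \<rho>"
    then have "Q k0 = Q 1" using k0 \<rho> unfolding constant_on_def by (metis centre_in_ball)
    then show False using neg[OF k0] Q1 by simp
  qed
  have one_in: "1 \<in> ball (1::complex) \<rho>" using \<rho> by simp
  obtain g r n where n: "0 < n" and r: "0 < r" "ball (1::complex) r \<subseteq> ball 1 \<rho>"
    and g: "g holomorphic_on ball 1 r" "\<And>w. w \<in> ball 1 r \<Longrightarrow> Q w = (w - 1) ^ n * g w"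
      "\<And>w. w \<in> ball 1 r \<Longrightarrow> g w \<noteq> 0"
    by (rule holomorphic_factor_zero_nonconstant[OF hol open_ball connected_ball one_in Q1 nonconst])
       (rule that)
  have g_cont: "isCont g 1"
    using holomorphic_on_imp_continuous_on[OF g(1)] r(1) by (simp add: continuous_on_eq_continuous_at)
  define c where "c = (-1) ^ n * g 1"
  have "c \<noteq> 0" using g(3)[of 1] r(1) by (simp add: c_def)
  \<comment> \<open>the cone condition: the limit of the sign condition along a ray into the disc\<close>
  have cone: "Re c * cos (n * \<phi>) - Im c * sin (n * \<phi>) \<le> 0" if "\<bar>\<phi>\<bar> < pi / 2" for \<phi> :: real
  proof -
    define u where "u = - cis \<phi>"
    have u_pow: "u ^ n * g 1 = c * cis (n * \<phi>)"
      unfolding u_def c_def by (simp add: power_minus[of "cis \<phi>"] Complex.DeMoivre algebra_simps)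
    have Re_u: "Re u < 0" using that cos_gt_zero_pi[of \<phi>] by (simp add: u_def abs_less_iff)
    have lim: "((\<lambda>t. 1 + of_real t * u) \<longlongrightarrow> 1 + of_real 0 * u) (at_right (0::real))"
      by (intro tendsto_intros)
    have "((\<lambda>t. Re (u ^ n * g (1 + of_real t * u))) \<longlongrightarrow> Re (u ^ n * g 1)) (at_right (0::real))"
      using g_cont lim by (intro tendsto_intros isCont_tendsto_compose[of _ g]) auto
    moreover have "\<forall>\<^sub>F t in at_right (0::real). Re (u ^ n * g (1 + of_real t * u)) \<le> 0"
    proof -
      have "\<forall>\<^sub>F t in at_right (0::real). 1 + of_real t * u \<in> ball 1 r"
        using lim r(1) by (intro topological_tendstoD[of _ _ _ "ball 1 r"]) auto
      \<comment> \<open>this bound on \<open>t\<close> is exactly what keeps \<open>1 + t u\<close> inside the unit disc\<close>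
      moreover have "\<forall>\<^sub>F t in at_right (0::real). t < - 2 * Re u"
        using Re_u by (intro eventually_at_right_real[THEN eventually_mono, of 0]) auto
      moreover have "\<forall>\<^sub>F t in at_right (0::real). 0 < t" by (rule eventually_at_right_less)
      ultimately show ?thesis
      proof eventually_elim
        case (elim t)
        let ?k = "1 + of_real t * u"
        have "(norm ?k)\<^sup>2 = 1 + t * (2 * Re u + t * (norm u)\<^sup>2)"
          by (simp add: cmod_power2) (simp add: algebra_simps power2_eq_square)
        also have "\<dots> = 1 + t * (2 * Re u + t)" by (simp add: u_def)
        also have "\<dots> < 1" using elim by (simp add: mult_pos_neg)
        finally have "norm ?k < 1" by (simp add: power_less_one_iff)
        then have "Re (Q ?k) < 0" using neg r(2) elim(1) by blast
        moreover have "Q ?k = of_real (t ^ n) * (u ^ n * g ?k)"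
          using g(2)[OF elim(1)] by (simp add: power_mult_distrib)
        ultimately have "t ^ n * Re (u ^ n * g ?k) < 0" by simp
        then show ?case using elim(3) by (simp add: mult_less_0_iff zero_less_power not_less)
      qed
    qed
    ultimately have "Re (u ^ n * g 1) \<le> 0" by (intro tendsto_upperbound) auto
    then show ?thesis unfolding u_pow by simp
  qed
  have "n = 1"
  proof (rule ccontr)
    assume "n \<noteq> 1"
    then have n2: "2 \<le> real n" using n by simp
    have small: "\<bar>x / n\<bar> < pi / 2" if "\<bar>x\<bar> < pi" for x :: real
    proof -
      have "\<bar>x / n\<bar> \<le> \<bar>x\<bar> / 2" using n2 unfolding abs_divide by (intro frac_le) auto
      then show ?thesis using that by simp
    qed
    have cone': "Re c * cos x - Im c * sin x \<le> 0" if "\<bar>x\<bar> < pi" for x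
      using cone[OF small[OF that]] n by simp
    \<comment> \<open>the directions \<open>\<plusminus> \<pi>/2\<close>, \<open>0\<close> and \<open>2 \<pi>/3\<close> already exclude every nonzero \<open>c\<close>\<close>
    have "Im c = 0" using cone'[of "pi/2"] cone'[of "-(pi/2)"] by simp
    moreover have "Re c \<le> 0" using cone'[of 0] by simp
    moreover have "Re c \<ge> 0" using cone'[of "2*pi/3"] \<open>Im c = 0\<close> by (simp add: cos_120)
    ultimately show False using \<open>c \<noteq> 0\<close> by (simp add: complex_eq_iff)
  qed
  have "Re c < 0"
  proof (rule ccontr)
    assume "\<not> Re c < 0"
    then have "Re c = 0" using cone[of 0] by simp
    then have "Im c = 0"
      using cone[of "pi/4"] cone[of "-(pi/4)"] \<open>n = 1\<close> by (simp add: sin_45)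
    then show False using \<open>Re c = 0\<close> \<open>c \<noteq> 0\<close> by (simp add: complex_eq_iff)
  qed
  then have "0 < Re (g 1)" using \<open>n = 1\<close> by (simp add: c_def)
  have lim: "((\<lambda>t. 1 + of_real t) \<longlongrightarrow> 1 + (of_real 0 :: complex)) (at_right (0::real))"
    by (intro tendsto_intros)
  then have "((\<lambda>t. Re (g (1 + of_real t))) \<longlongrightarrow> Re (g 1)) (at_right (0::real))"
    using g_cont by (intro tendsto_intros isCont_tendsto_compose[of _ g]) auto
  then have "\<forall>\<^sub>F t in at_right (0::real). 0 < Re (g (1 + of_real t))"
    using \<open>0 < Re (g 1)\<close> by (rule order_tendstoD)
  moreover have "\<forall>\<^sub>F t in at_right (0::real). 1 + of_real t \<in> ball (1::complex) r"
    using lim r(1) by (intro topological_tendstoD[of _ _ _ "ball 1 r"]) auto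
  moreover have "\<forall>\<^sub>F t in at_right (0::real). 0 < t" by (rule eventually_at_right_less)
  ultimately show ?thesis
  proof eventually_elim
    case (elim t)
    show ?case using g(2)[OF elim(2)] \<open>n = 1\<close> elim by simp
  qed
qed

text \<open>A polynomial in two variables is a polynomial in \<open>s\<close> with coefficients that are polynomials in \<open>k\<close>. This
  makes evaluation a ring homomorphism, so that it commutes with determinants.\<close>

definition bieval :: "'a::comm_semiring_1 poly poly \<Rightarrow> 'a \<Rightarrow> 'a \<Rightarrow> 'a" where
  "bieval p s k = poly (poly p [:s:]) k"

lemma bieval_pCons: "bieval (pCons a p) s k = poly a k + s * bieval p s k"
  by (simp add: bieval_def)

lemma bieval_sum: "bieval (sum f A) s k = (\<Sum>i\<in>A. bieval (f i) s k)"
  by (simp add: bieval_def poly_sum)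

lemma bieval_prod: "bieval (prod f A) s k = (\<Prod>i\<in>A. bieval (f i) s k)"
  by (simp add: bieval_def poly_prod)

lemma bieval_of_int_mult: "bieval (of_int n * p) s k = of_int n * bieval p s k"
  for p :: "'a::comm_ring_1 poly poly"
  by (simp add: bieval_def of_int_poly)

lemma bieval_det: "bieval (det M) s k = det (\<chi> i j. bieval (M $ i $ j) s k)"
  for M :: "'a::comm_ring_1 poly poly^'n^'n"
  by (simp add: det_def bieval_sum bieval_prod bieval_of_int_mult)

lemma continuous_on_bieval [continuous_intros]:
  fixes p :: "complex poly poly"
  assumes "continuous_on A f" "continuous_on A g"
  shows "continuous_on A (\<lambda>x. bieval p (f x) (g x))"
proof (induction p)
  case (pCons a p)
  then show ?case unfolding bieval_pCons by (intro continuous_intros assms)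
qed (simp add: bieval_def)

lemma has_field_derivative_bieval_fst:
  fixes p :: "complex poly poly"
  shows "((\<lambda>s. bieval p s k) has_field_derivative bieval (pderiv p) s k) (at s within S)"
proof (induction p)
  case (pCons a p)
  have "bieval (pderiv (pCons a p)) s k = bieval p s k + s * bieval (pderiv p) s k"
    by (simp add: bieval_def pderiv_pCons)
  then show ?case unfolding bieval_pCons
    by (auto intro!: derivative_eq_intros pCons.IH)
qed (simp add: bieval_def)

lemma has_field_derivative_bieval_snd:
  fixes p :: "complex poly poly"
  shows "((\<lambda>k. bieval p s k) has_field_derivative bieval (map_poly pderiv p) s k) (at k within S)"
proof (induction p)
  case (pCons a p)
  then show ?case unfolding bieval_pCons
    by (auto simp: map_poly_pCons bieval_pCons intro!: derivative_eq_intros pCons.IH poly_DERIV[THEN DERIV_subset])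
qed (simp add: bieval_def)

text \<open>The zeros near \<open>s0\<close> are tracked through the sum \<open>Q\<close> of their displacements from \<open>s0\<close>, counted with multiplicity.
  By the argument principle it is a contour integral over a circle that no zero meets while \<open>k\<close> is near 1.\<close>

lemma root_crosses_imaginary_axis:
  fixes p :: "complex poly poly"
  assumes nz: "\<And>s k. 0 \<le> Re s \<Longrightarrow> norm k < 1 \<Longrightarrow> bieval p s k \<noteq> 0"
    and s0: "Re s0 = 0" "bieval p s0 1 = 0" and nontriv: "bieval p s1 1 \<noteq> 0"
  shows "\<forall>\<^sub>F \<epsilon> in at_right (0::real). \<exists>s. 0 < Re s \<and> bieval p s (1 + of_real \<epsilon>) = 0"
proof -
  define F where "F = bieval p"
  have F_fst: "((\<lambda>s. F s k) has_field_derivative bieval (pderiv p) s k) (at s within A)" for s k A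
    unfolding F_def by (rule has_field_derivative_bieval_fst)
  have F_snd: "((\<lambda>k. F s k) has_field_derivative bieval (map_poly pderiv p) s k) (at k within A)" for s k A
    unfolding F_def using has_field_derivative_bieval_snd[of p s k A] by simp
  have F_cont: "continuous_on A f \<Longrightarrow> continuous_on A g \<Longrightarrow> continuous_on A (\<lambda>x. F (f x) (g x))"
    for A :: "'z::topological_space set" and f g
    unfolding F_def by (intro continuous_intros)
  have F_hol: "(\<lambda>s. F s k) holomorphic_on A" for k A
    using F_fst unfolding holomorphic_on_def field_differentiable_def by blast
  obtain r where r: "0 < r" "\<And>z. z \<in> ball s0 r - {s0} \<Longrightarrow> F z 1 \<noteq> 0"
    using isolated_zeros[OF F_hol[of 1 UNIV], of s0 s1] s0 nontriv by (auto simp: F_def)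
  define R where "R = r / 2"
  have R: "0 < R" using r by (simp add: R_def)
  have R_nz: "F z 1 \<noteq> 0" if "z \<in> cball s0 R" "z \<noteq> s0" for z
    using r(2)[of z] that R by (simp add: R_def)
  obtain m where m: "0 < m" "\<And>z. z \<in> sphere s0 R \<Longrightarrow> m \<le> norm (F z 1)"
  proof -
    obtain z where z: "z \<in> sphere s0 R" "\<And>y. y \<in> sphere s0 R \<Longrightarrow> norm (F z 1) \<le> norm (F y 1)"
      using continuous_attains_inf[of "sphere s0 R" "\<lambda>z. norm (F z 1)"] R
      by (force intro!: continuous_intros F_cont)
    then show ?thesis using that[of "norm (F z 1)"] R_nz[of z] R by auto
  qed
  \<comment> \<open>for \<open>k\<close> near 1, the polynomial stays within \<open>m / 2\<close> of its value at \<open>k = 1\<close>, hence away from 0 on the circle\<close>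
  obtain \<rho>1 where \<rho>1: "0 < \<rho>1" "\<And>z k. z \<in> cball s0 R \<Longrightarrow> k \<in> ball 1 \<rho>1 \<Longrightarrow> norm (F z k - F z 1) < m / 2"
  proof -
    have "compact (cball s0 R \<times> cball (1::complex) 1)" by (intro compact_Times compact_cball)
    then have "uniformly_continuous_on (cball s0 R \<times> cball 1 1) (\<lambda>x. F (fst x) (snd x))"
      by (intro compact_uniformly_continuous F_cont continuous_intros)
    then obtain d where d: "0 < d" "\<And>x y. x \<in> cball s0 R \<times> cball 1 1 \<Longrightarrow> y \<in> cball s0 R \<times> cball 1 1
        \<Longrightarrow> dist y x < d \<Longrightarrow> dist (F (fst y) (snd y)) (F (fst x) (snd x)) < m / 2"
      unfolding uniformly_continuous_on_def using m(1) by (metis half_gt_zero)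
    show ?thesis
    proof (rule that[of "min d 1"])
      fix z k :: complex assume "z \<in> cball s0 R" "k \<in> ball 1 (min d 1)"
      then show "norm (F z k - F z 1) < m / 2"
        using d(2)[of "(z, 1)" "(z, k)"] by (simp add: dist_norm dist_Pair_Pair norm_minus_commute)
    qed (use d(1) in auto)
  qed
  have far: "m / 2 < norm (F z k)" if "z \<in> sphere s0 R" "k \<in> ball 1 \<rho>1" for z k
  proof -
    have "norm (F z k - F z 1) < m / 2" using that by (intro \<rho>1(2)) auto
    moreover have "norm (F z 1) - norm (F z k) \<le> norm (F z k - F z 1)"
      by (metis norm_minus_commute norm_triangle_ineq2)
    ultimately show ?thesis using m(2)[OF that(1)] by linarith
  qed
  \<comment> \<open>otherwise the maximum principle for \<open>1 / F\<close> would bound \<open>F s0 k\<close> away from 0, whereas \<open>F s0 1 = 0\<close>;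
    this is what keeps the sum \<open>Q\<close> from being empty, and thus from vanishing identically\<close>
  have zero_inside: "\<exists>z\<in>ball s0 R. F z k = 0" if k: "k \<in> ball 1 \<rho>1" for k
  proof (rule ccontr)
    assume no: "\<not> (\<exists>z\<in>ball s0 R. F z k = 0)"
    have nz: "F z k \<noteq> 0" if "z \<in> cball s0 R" for z
      using no far[OF _ k, of z] m(1) that by (cases "z \<in> ball s0 R") (auto simp: less_le)
    have "norm (inverse (F s0 k)) \<le> 2 / m"
    proof (rule maximum_modulus_frontier[of "\<lambda>z. inverse (F z k)" "cball s0 R"])
      show "(\<lambda>z. inverse (F z k)) holomorphic_on interior (cball s0 R)"
        using nz by (intro holomorphic_on_inverse F_hol) auto
      show "continuous_on (closure (cball s0 R)) (\<lambda>z. inverse (F z k))"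
        using nz by (intro continuous_intros F_cont) auto
      fix z assume "z \<in> frontier (cball s0 R)"
      then have "m / 2 < norm (F z k)" using far k by (auto simp: sphere_def)
      then show "norm (inverse (F z k)) \<le> 2 / m"
        using m(1) le_imp_inverse_le[of "m / 2" "norm (F z k)"] by (simp add: norm_inverse)
    qed (use R in auto)
    moreover have "norm (F s0 k) < m / 2" using \<rho>1(2)[of s0 k] k s0 R by (simp add: F_def)
    then have "inverse (m / 2) < norm (inverse (F s0 k))"
      using nz[of s0] R by (simp add: norm_inverse less_imp_inverse_less del: inverse_divide)
    ultimately show False by simp
  qed
  define h where "h k z = bieval (pderiv p) z k * (z - s0) / F z k" for k z
  define Q where "Q k = contour_integral (circlepath s0 R) (h k) / (2 * pi * \<i>)" for k
  \<comment> \<open>differentiation under the integral sign; \<open>h'\<close> is the derivative of \<open>h\<close> in \<open>k\<close>\<close>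
  have Q_hol: "Q holomorphic_on ball 1 \<rho>1"
  proof -
    define h' where "h' k z = (bieval (map_poly pderiv (pderiv p)) z k * (z - s0) * F z k
        - bieval (pderiv p) z k * (z - s0) * bieval (map_poly pderiv p) z k) / (F z k * F z k)" for k z
    define v where "v t = 2 * pi * \<i> * R * exp (2 * of_real pi * \<i> * of_real t)" for t :: real
    define c where "c = circlepath s0 R"
    have c_in: "c t \<in> sphere s0 R" if "t \<in> {0..1}" for t
      using path_image_circlepath[of s0 R] that R unfolding path_image_def c_def by auto
    have c_nz: "F (c t) k \<noteq> 0" if "t \<in> {0..1}" "k \<in> ball 1 \<rho>1" for t k
      using far[OF c_in[OF that(1)] that(2)] m(1) by auto
    have c_cont: "continuous_on A c" for A
      unfolding c_def continuous_on_eq_continuous_within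
      by (blast intro: has_vector_derivative_continuous has_vector_derivative_circlepath)
    have "(\<lambda>k. integral (cbox 0 1) (\<lambda>t. h k (c t) * v t)) holomorphic_on ball 1 \<rho>1"
    proof (rule leibniz_rule_holomorphic[where fx="\<lambda>k t. h' k (c t) * v t"])
      fix k :: complex and t :: real assume kt: "k \<in> ball 1 \<rho>1" "t \<in> cbox 0 1"
      then have "F (c t) k \<noteq> 0" using c_nz by auto
      then show "((\<lambda>k. h k (c t) * v t) has_field_derivative h' k (c t) * v t) (at k within ball 1 \<rho>1)"
        unfolding h_def h'_def
        by (auto intro!: derivative_eq_intros has_field_derivative_bieval_snd F_snd simp: algebra_simps)
    next
      fix k :: complex assume "k \<in> ball 1 \<rho>1"
      then show "(\<lambda>t. h k (c t) * v t) integrable_on cbox 0 1"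
        unfolding h_def v_def using c_nz
        by (intro integrable_continuous continuous_intros F_cont c_cont) auto
    next
      have "continuous_on (ball 1 \<rho>1 \<times> cbox 0 1) (\<lambda>x. h' (fst x) (c (snd x)) * v (snd x))"
        unfolding h'_def v_def using c_nz
        by (intro continuous_intros F_cont continuous_on_compose2[OF c_cont[of UNIV]]) auto
      then show "continuous_on (ball 1 \<rho>1 \<times> cbox 0 1) (\<lambda>(k, t). h' k (c t) * v t)"
        by (simp add: split_beta)
    qed simp
    then show ?thesis
      unfolding Q_def contour_integral_integral vector_derivative_circlepath v_def c_def
      by (intro holomorphic_intros) auto
  qed
  define Z where "Z k = {z \<in> ball s0 R. F z k = 0}" for k
  \<comment> \<open>argument principle, applied in a disc larger than the one bounded by the circle; the zeros in between
    have winding number 0 and drop out\<close>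
  have Q_eq: "finite (Z k) \<and> Q k = (\<Sum>z\<in>Z k. (z - s0) * of_int (zorder (\<lambda>s. F s k) z))
      \<and> (\<forall>z\<in>Z k. 0 < zorder (\<lambda>s. F s k) z)"
    if k: "k \<in> ball 1 \<rho>1" for k
  proof -
    let ?f = "\<lambda>s. F s k" and ?S = "ball s0 (2 * R)" and ?c = "circlepath s0 R"
    define pz where "pz = {w \<in> ?S. ?f w = 0 \<or> w \<in> {}}"
    have z1: "F (s0 + of_real R) k \<noteq> 0" using far[of "s0 + of_real R" k] k m(1) R by (auto simp: dist_norm)
    obtain z2 where z2: "F z2 k = 0" using zero_inside[OF k] by blast
    have nonconst: "\<not> ?f constant_on UNIV" using z1 z2 unfolding constant_on_def by (metis UNIV_I)
    have "finite {z \<in> cball s0 (2 * R). ?f z = 0}"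
      by (rule holomorphic_compact_finite_zeros[OF F_hol _ _ _ _ nonconst]) auto
    then have fin: "finite pz" by (rule finite_subset[rotated]) (auto simp: pz_def)
    have Z_pz: "Z k \<subseteq> pz" using R by (auto simp: Z_def pz_def)
    have "contour_integral ?c (\<lambda>z. deriv ?f z * (z - s0) / ?f z)
        = 2 * pi * \<i> * (\<Sum>z\<in>pz. winding_number ?c z * (z - s0) * zorder ?f z)"
      unfolding pz_def
    proof (rule argument_principle)
      show "path_image ?c \<subseteq> ?S - {w \<in> ?S. ?f w = 0 \<or> w \<in> {}}"
        using far[OF _ k] m(1) R by (force simp: dist_norm)
      show "\<forall>z. z \<notin> ?S \<longrightarrow> winding_number ?c z = 0"
        using R by (auto intro!: winding_number_zero_outside[where s="ball s0 (2 * R)"])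
      show "finite {w \<in> ?S. ?f w = 0 \<or> w \<in> {}}" using fin by (simp add: pz_def)
    qed (auto intro!: F_hol holomorphic_intros)
    also have "(\<Sum>z\<in>pz. winding_number ?c z * (z - s0) * zorder ?f z)
        = (\<Sum>z\<in>Z k. (z - s0) * of_int (zorder ?f z))"
    proof (rule sum.mono_neutral_cong_right[OF fin Z_pz])
      show "\<forall>z\<in>pz - Z k. winding_number ?c z * (z - s0) * zorder ?f z = 0"
      proof
        fix z assume z: "z \<in> pz - Z k"
        then have "z \<notin> sphere s0 R" using far[OF _ k, of z] m(1) by (auto simp: pz_def)
        then have "z \<notin> cball s0 R" using z by (auto simp: pz_def Z_def)
        then have "winding_number ?c z = 0"
          using R by (intro winding_number_zero_outside[where s="cball s0 R"]) auto
        then show "winding_number ?c z * (z - s0) * zorder ?f z = 0" by simp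
      qed
    qed (auto simp: Z_def winding_number_circlepath dist_norm norm_minus_commute)
    also have "(\<lambda>z. deriv ?f z * (z - s0) / ?f z) = h k"
      unfolding h_def using DERIV_imp_deriv[OF F_fst] by auto
    finally have "Q k = (\<Sum>z\<in>Z k. (z - s0) * of_int (zorder ?f z))" by (simp add: Q_def)
    moreover have "0 < zorder ?f z" if "z \<in> Z k" for z
    proof (subst zorder_pos_iff[OF F_hol, of UNIV])
      have "\<not> z islimpt {w \<in> cball z 1. ?f w = 0}"
        using islimpt_finite holomorphic_compact_finite_zeros[OF F_hol _ _ _ _ nonconst, of "cball z 1"] by auto
      then have "\<forall>\<^sub>F w in at z. w \<notin> {w \<in> cball z 1. ?f w = 0}"
        by (simp add: islimpt_iff_eventually)
      moreover have "\<forall>\<^sub>F w in at z. w \<in> ball z 1"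
        by (intro eventually_at_in_open') auto
      ultimately have "\<forall>\<^sub>F w in at z. ?f w \<noteq> 0" by eventually_elim auto
      then show "\<exists>\<^sub>F w in at z. ?f w \<noteq> 0" by (intro eventually_frequently) auto
      show "?f z = 0" using that by (simp add: Z_def)
    qed auto
    ultimately show ?thesis using finite_subset[OF Z_pz fin] by blast
  qed
  have Re_Q: "Re (Q k) = (\<Sum>z\<in>Z k. Re z * of_int (zorder (\<lambda>s. F s k) z))" if "k \<in> ball 1 \<rho>1" for k
    using Q_eq[OF that] s0(1) by simp
  have "\<forall>\<^sub>F \<epsilon> in at_right (0::real). 0 < Re (Q (1 + of_real \<epsilon>))"
  proof (rule Re_pos_beyond_boundary_zero[OF Q_hol \<rho>1(1)])
    have "Z 1 = {s0}" using R_nz s0 R by (force simp: Z_def F_def)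
    then show "Q 1 = 0" using Q_eq[of 1] \<rho>1(1) by simp
    fix k :: complex assume k: "k \<in> ball 1 \<rho>1" "norm k < 1"
    have "Re z < 0" if "z \<in> Z k" for z
      using nz[of z k] k(2) that by (force simp: Z_def F_def)
    moreover have "Z k \<noteq> {}" using zero_inside[OF k(1)] by (auto simp: Z_def)
    ultimately show "Re (Q k) < 0"
      unfolding Re_Q[OF k(1)]
      using Q_eq[OF k(1)] sum_strict_mono[of "Z k" "\<lambda>z. Re z * of_int (zorder (\<lambda>s. F s k) z)" "\<lambda>_. 0"]
      by (auto simp: mult_neg_pos)
  qed
  moreover have "\<forall>\<^sub>F \<epsilon> in at_right (0::real). \<epsilon> \<in> {0<..<\<rho>1}"
    using \<rho>1(1) by (rule eventually_at_right_real)
  ultimately show ?thesis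
  proof eventually_elim
    case (elim \<epsilon>)
    then have k: "1 + of_real \<epsilon> \<in> ball (1::complex) \<rho>1" by (simp add: dist_norm)
    have "\<exists>z\<in>Z (1 + of_real \<epsilon>). 0 < Re z"
    proof (rule ccontr)
      assume "\<not> ?thesis"
      then have "Re (Q (1 + of_real \<epsilon>)) \<le> 0"
        unfolding Re_Q[OF k] using Q_eq[OF k]
        by (intro sum_nonpos) (auto intro!: mult_nonpos_nonneg simp: not_less less_imp_le)
      then show False using elim by simp
    qed
    then show ?case by (auto simp: Z_def F_def)
  qed
qed

section \<open>Stacked vectors and determinants of affine pencils\<close>

definition vjoin :: "'a^'n \<Rightarrow> 'a^'m \<Rightarrow> 'a^('n::finite + 'm::finite)" where
  "vjoin x y = (\<chi> i. case i of Inl a \<Rightarrow> x $ a | Inr b \<Rightarrow> y $ b)"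

definition hjoin :: "'a^'n^'k \<Rightarrow> 'a^'m^'k \<Rightarrow> 'a^('n::finite + 'm::finite)^'k" where
  "hjoin M N = (\<chi> i. vjoin (M $ i) (N $ i))"

lemma vjoin_nth [simp]: "vjoin x y $ Inl a = x $ a" "vjoin x y $ Inr b = y $ b"
  by (simp_all add: vjoin_def)

lemma vec_sum_eq_iff: "(v :: 'a^('n::finite + 'm::finite)) = w \<longleftrightarrow>
    (\<forall>a. v $ Inl a = w $ Inl a) \<and> (\<forall>b. v $ Inr b = w $ Inr b)"
  unfolding vec_eq_iff by (metis sum.exhaust)

lemma sum_UNIV_sum: "(\<Sum>i\<in>(UNIV :: ('n::finite + 'm::finite) set). f i) = (\<Sum>a\<in>UNIV. f (Inl a)) + (\<Sum>b\<in>UNIV. f (Inr b))"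
  by (subst UNIV_Plus_UNIV[symmetric], subst sum.Plus) (simp_all add: o_def)

lemma vjoin_eq_iff [simp]: "vjoin x y = vjoin x' y' \<longleftrightarrow> x = x' \<and> y = y'"
  by (auto simp: vec_sum_eq_iff vec_eq_iff)

lemma vjoin_0 [simp]: "vjoin 0 0 = 0"
  by (simp add: vec_sum_eq_iff)

lemma vjoin_eq_0_iff [simp]: "vjoin x y = 0 \<longleftrightarrow> x = 0 \<and> y = 0"
  by (metis vjoin_0 vjoin_eq_iff)

lemma vjoin_add: "vjoin x y + vjoin x' y' = vjoin (x + x') (y + y')"
  by (simp add: vec_sum_eq_iff)

lemma vjoin_smult: "c *s vjoin x y = vjoin (c *s x) (c *s y)"
  by (simp add: vec_sum_eq_iff)

lemma vjoin_cases: obtains x y where "v = vjoin x y"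
proof
  show "v = vjoin (\<chi> a. v $ Inl a) (\<chi> b. v $ Inr b)" by (simp add: vec_sum_eq_iff)
qed

lemma vjoin_mult_vec: "vjoin M N *v x = vjoin (M *v x) (N *v x)"
  by (simp add: vec_sum_eq_iff matrix_vector_mult_def)

lemma hjoin_mult_vjoin: "hjoin M N *v vjoin x y = M *v x + N *v y"
  by (simp add: vec_eq_iff matrix_vector_mult_def hjoin_def sum_UNIV_sum)

lemma det_eq_0_iff_kernel: "det (M :: 'a::field^'n^'n) = 0 \<longleftrightarrow> (\<exists>v. v \<noteq> 0 \<and> M *v v = 0)"
  using invertible_det_nz[of M] invertible_left_inverse[of M] matrix_left_invertible_ker[of M] by auto

lemma mat_mult_vec: "mat s *v v = s *s v" for v :: "'a::comm_semiring_1^'n"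
  by (simp add: vec_eq_iff matrix_vector_mult_def mat_def if_distrib if_distribR cong: if_cong)

text \<open>The determinant is taken over the ring of bivariate polynomials, and only then evaluated.\<close>

lemma det_affine_pencil_bieval:
  fixes M0 M1 M2 :: "complex^'d^'d"
  obtains p where "\<And>s k. bieval p s k = 0 \<longleftrightarrow> (\<exists>v. v \<noteq> 0 \<and> M0 *v v + s *s (M1 *v v) + k *s (M2 *v v) = 0)"
proof
  define M where "M = (\<chi> i j. [:[:M0 $ i $ j, M2 $ i $ j:], [:M1 $ i $ j:]:])"
  fix s k
  define E where "E = (\<chi> i j. bieval (M $ i $ j) s k)"
  have "E *v v = M0 *v v + s *s (M1 *v v) + k *s (M2 *v v)" for v
    by (simp add: vec_eq_iff E_def M_def bieval_def matrix_vector_mult_def algebra_simps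
        sum.distrib sum_distrib_left)
  then show "bieval (det M) s k = 0 \<longleftrightarrow> (\<exists>v. v \<noteq> 0 \<and> M0 *v v + s *s (M1 *v v) + k *s (M2 *v v) = 0)"
    unfolding bieval_det E_def[symmetric] det_eq_0_iff_kernel by simp
qed

section \<open>Modes of the linear feedback loop and the small-gain theorem\<close>

text \<open>The solution \<open>e\<^sup>s\<^sup>t (x, y, w)\<close> of the loop with gain \<open>k\<close>. The input \<open>w\<close> is kept as an unknown,
  so that the equations are affine in both \<open>s\<close> and \<open>k\<close> and need no inverse of \<open>I - k D' D\<close>.\<close>

definition loop_mode ::
  "('n::finite, 'm::finite, 'p::finite) lti \<Rightarrow> ('k::finite, 'p, 'm) lti \<Rightarrow> complex \<Rightarrow> complex \<Rightarrow>
     complex^'n \<Rightarrow> complex^'k \<Rightarrow> complex^'m \<Rightarrow> bool" where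
  "loop_mode G \<Delta> s k x y w \<longleftrightarrow>
     s *s x = cmat (lti_A G) *v x + cmat (lti_B G) *v w \<and>
     s *s y = cmat (lti_A \<Delta>) *v y + cmat (lti_B \<Delta>) *v (cmat (lti_C G) *v x + cmat (lti_D G) *v w) \<and>
     w = k *s (cmat (lti_C \<Delta>) *v y + cmat (lti_D \<Delta>) *v (cmat (lti_C G) *v x + cmat (lti_D G) *v w))"

lemma uminus_mult_vec: "(- M) *v x = - (M *v x)" for M :: "'a::ring_1^'n^'m"
  by (simp add: vec_eq_iff matrix_vector_mult_def sum_negf)

lemma characteristic_bipolynomial_of_loop:
  fixes G :: "('n::finite, 'm::finite, 'p::finite) lti" and \<Delta> :: "('k::finite, 'p, 'm) lti"
  obtains p where "\<And>s k. bieval p s k = 0 \<longleftrightarrow>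
    (\<exists>x y w. (x \<noteq> 0 \<or> y \<noteq> 0 \<or> w \<noteq> 0) \<and> loop_mode G \<Delta> s k x y w)"
proof -
  let ?A = "cmat (lti_A G)" and ?B = "cmat (lti_B G)" and ?C = "cmat (lti_C G)" and ?D = "cmat (lti_D G)"
  let ?A' = "cmat (lti_A \<Delta>)" and ?B' = "cmat (lti_B \<Delta>)" and ?C' = "cmat (lti_C \<Delta>)" and ?D' = "cmat (lti_D \<Delta>)"
  \<comment> \<open>the coefficients of \<open>1\<close>, \<open>s\<close> and \<open>k\<close> in the loop equations; the block rows are the equations for
    the plant state, the attack state and the input\<close>
  define M0 where "M0 = vjoin (hjoin (- ?A) (hjoin (0 :: complex^'k^'n) (- ?B)))
     (vjoin (hjoin (- (?B' ** ?C)) (hjoin (- ?A') (- (?B' ** ?D)))) (hjoin (0 :: complex^'n^'m) (hjoin (0 :: complex^'k^'m) (mat 1))))"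
  define M1 where "M1 = vjoin (hjoin (mat 1 :: complex^'n^'n) (hjoin (0 :: complex^'k^'n) (0 :: complex^'m^'n)))
     (vjoin (hjoin (0 :: complex^'n^'k) (hjoin (mat 1) (0 :: complex^'m^'k))) (hjoin (0 :: complex^'n^'m) (hjoin (0 :: complex^'k^'m) 0)))"
  define M2 where "M2 = vjoin (hjoin (0 :: complex^'n^'n) (hjoin (0 :: complex^'k^'n) (0 :: complex^'m^'n)))
     (vjoin (hjoin (0 :: complex^'n^'k) (hjoin 0 (0 :: complex^'m^'k))) (hjoin (- (?D' ** ?C)) (hjoin (- ?C') (- (?D' ** ?D)))))"
  obtain p where p: "\<And>s k. bieval p s k = 0 \<longleftrightarrow> (\<exists>v. v \<noteq> 0 \<and> M0 *v v + s *s (M1 *v v) + k *s (M2 *v v) = 0)"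
    by (rule det_affine_pencil_bieval[of M0 M1 M2]) (rule that)
  have "M0 *v vjoin x (vjoin y w) + s *s (M1 *v vjoin x (vjoin y w)) + k *s (M2 *v vjoin x (vjoin y w)) =
      vjoin (s *s x - (?A *v x + ?B *v w)) (vjoin (s *s y - (?A' *v y + ?B' *v (?C *v x + ?D *v w)))
        (w - k *s (?C' *v y + ?D' *v (?C *v x + ?D *v w))))" for s k x y w
    unfolding M0_def M1_def M2_def
    by (simp add: vjoin_mult_vec hjoin_mult_vjoin vjoin_add vjoin_smult uminus_mult_vec
        matrix_vector_mul_assoc[symmetric] matrix_vector_right_distrib)
  then have mode: "M0 *v vjoin x (vjoin y w) + s *s (M1 *v vjoin x (vjoin y w)) + k *s (M2 *v vjoin x (vjoin y w)) = 0
      \<longleftrightarrow> loop_mode G \<Delta> s k x y w" for s k x y w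
    by (simp add: loop_mode_def)
  have "bieval p s k = 0 \<longleftrightarrow> (\<exists>x y w. (x \<noteq> 0 \<or> y \<noteq> 0 \<or> w \<noteq> 0) \<and> loop_mode G \<Delta> s k x y w)" for s k
  proof
    assume "bieval p s k = 0"
    then obtain v where v: "v \<noteq> 0" "M0 *v v + s *s (M1 *v v) + k *s (M2 *v v) = 0"
      unfolding p by blast
    obtain x yw where "v = vjoin x yw" by (rule vjoin_cases)
    moreover obtain y w where "yw = vjoin y w" by (rule vjoin_cases)
    ultimately have xyw: "v = vjoin x (vjoin y w)" by simp
    show "\<exists>x y w. (x \<noteq> 0 \<or> y \<noteq> 0 \<or> w \<noteq> 0) \<and> loop_mode G \<Delta> s k x y w"
      using v unfolding xyw mode by auto
  next
    assume "\<exists>x y w. (x \<noteq> 0 \<or> y \<noteq> 0 \<or> w \<noteq> 0) \<and> loop_mode G \<Delta> s k x y w"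
    then obtain x y w where xyw: "x \<noteq> 0 \<or> y \<noteq> 0 \<or> w \<noteq> 0" "loop_mode G \<Delta> s k x y w" by blast
    then show "bieval p s k = 0"
      unfolding p by (intro exI[of _ "vjoin x (vjoin y w)"]) (simp add: mode)
  qed
  then show ?thesis by (rule that)
qed

lemma invertible_iff_kernel: "invertible (M :: 'a::field^'n^'n) \<longleftrightarrow> (\<forall>v. M *v v = 0 \<longrightarrow> v = 0)"
  using invertible_left_inverse[of M] matrix_left_invertible_ker[of M] by auto

lemma matrix_inv_mult_vec:
  fixes M :: "'a::field^'n^'n"
  assumes "invertible M" shows "M *v (matrix_inv M *v v) = v" "matrix_inv M *v (M *v v) = v"
proof -
  have "M ** matrix_inv M = mat 1 \<and> matrix_inv M ** M = mat 1"
    using assms unfolding invertible_def matrix_inv_def by (rule someI_ex)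
  then show "M *v (matrix_inv M *v v) = v" "matrix_inv M *v (M *v v) = v"
    by (simp_all add: matrix_vector_mul_assoc)
qed

lemma norm_smult_vec: "norm (c *s v) = norm c * norm v" for v :: "'a::real_normed_field^'n"
  by (simp add: norm_vec_def norm_mult L2_set_right_distrib)

lemma stable_lti_resolvent_invertible:
  assumes "stable_lti H" "0 \<le> Re s"
  shows "invertible (mat s - cmat (lti_A H))"
proof -
  have "v = 0" if "(mat s - cmat (lti_A H)) *v v = 0" for v
  proof (rule ccontr)
    assume "v \<noteq> 0"
    moreover have "cmat (lti_A H) *v v = s *s v"
      using that by (simp add: matrix_vector_mult_diff_rdistrib mat_mult_vec)
    ultimately show False using assms unfolding stable_lti_def by force
  qed
  then show ?thesis by (simp add: invertible_iff_kernel)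
qed

text \<open>The state response to the input \<open>e\<^sup>s\<^sup>t w\<close>: it exists, and its output is the transfer function applied to \<open>w\<close>.\<close>

lemma transfer_output:
  assumes "invertible (mat s - cmat (lti_A H))"
  shows "s *s x = cmat (lti_A H) *v x + cmat (lti_B H) *v w \<Longrightarrow>
      cmat (lti_C H) *v x + cmat (lti_D H) *v w = transfer H s *v w"
    and "\<exists>x. s *s x = cmat (lti_A H) *v x + cmat (lti_B H) *v w"
proof -
  let ?M = "mat s - cmat (lti_A H)"
  have M: "?M *v x = s *s x - cmat (lti_A H) *v x" for x
    by (simp add: matrix_vector_mult_diff_rdistrib mat_mult_vec)
  show "\<exists>x. s *s x = cmat (lti_A H) *v x + cmat (lti_B H) *v w"
    using matrix_inv_mult_vec(1)[OF assms, of "cmat (lti_B H) *v w"] unfolding M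
    by (metis add.commute diff_add_cancel)
  assume "s *s x = cmat (lti_A H) *v x + cmat (lti_B H) *v w"
  then have "?M *v x = cmat (lti_B H) *v w" by (simp add: M)
  then have "x = matrix_inv ?M *v (cmat (lti_B H) *v w)"
    using matrix_inv_mult_vec(2)[OF assms, of x] by simp
  then show "cmat (lti_C H) *v x + cmat (lti_D H) *v w = transfer H s *v w"
    by (simp add: transfer_def matrix_vector_mult_add_rdistrib matrix_vector_mul_assoc matrix_mul_assoc)
qed

lemma norm_mult_vec_le: "norm (M *v v) \<le> spectral_norm M * norm v"
  for M :: "complex^'n^'m"
  unfolding spectral_norm_def by (rule onorm) (rule matrix_vector_mul_bounded_linear)

text \<open>For large \<open>|s|\<close> the term \<open>s x\<close> dominates. The remaining part of the half-plane is compact, and there the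
  continuous function \<open>|s x - A x|\<close> of \<open>s\<close> and the unit vector \<open>x\<close> has a minimum, positive by stability.\<close>

lemma stable_lti_resolvent_bounded:
  assumes "stable_lti H"
  obtains K where "0 < K" "\<And>s x. 0 \<le> Re s \<Longrightarrow> norm x \<le> K * norm (s *s x - cmat (lti_A H) *v x)"
proof -
  let ?A = "cmat (lti_A H)"
  define a where "a = spectral_norm ?A"
  have "0 \<le> a" unfolding a_def spectral_norm_def by (intro onorm_pos_le matrix_vector_mul_bounded_linear)
  define S where "S = {s. 0 \<le> Re s} \<inter> cball 0 (a + 1)"
  define U where "U = sphere (0 :: complex^'a) 1"
  have "compact (S \<times> U)"
    unfolding S_def U_def by (intro compact_Times closed_Int_compact closed_halfspace_Re_ge) auto
  moreover have "0 \<in> S" using \<open>0 \<le> a\<close> by (simp add: S_def)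
  moreover have "U \<noteq> {}" by (simp add: U_def)
  moreover have "continuous_on (S \<times> U) (\<lambda>z. norm (fst z *s snd z - ?A *v snd z))"
    unfolding vector_scalar_mult_def
    by (intro continuous_intros linear_continuous_on_compose[of _ snd "(*v) ?A"] matrix_vector_mul_bounded_linear bounded_linear.linear)
  moreover have "S \<times> U \<noteq> {}" using \<open>0 \<in> S\<close> \<open>U \<noteq> {}\<close> by auto
  ultimately obtain z where z: "z \<in> S \<times> U" "\<And>z'. z' \<in> S \<times> U \<Longrightarrow>
      norm (fst z *s snd z - ?A *v snd z) \<le> norm (fst z' *s snd z' - ?A *v snd z')"
    using continuous_attains_inf[of "S \<times> U" "\<lambda>z. norm (fst z *s snd z - ?A *v snd z)"] by blast
  define m where "m = norm (fst z *s snd z - ?A *v snd z)"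
  have "m \<noteq> 0"
  proof
    assume "m = 0"
    then have "?A *v snd z = fst z *s snd z" by (simp add: m_def)
    moreover have "snd z \<noteq> 0" "0 \<le> Re (fst z)" using z(1) by (auto simp: S_def U_def)
    ultimately show False using assms unfolding stable_lti_def by force
  qed
  then have "0 < m" by (simp add: m_def)
  define K where "K = max 1 (1 / m)"
  have lin: "s *s (c *s u) - ?A *v (c *s u) = c *s (s *s u - ?A *v u)" for c s u
    by (simp add: vec_eq_iff matrix_vector_mult_def sum_distrib_left algebra_simps)
  have "norm x \<le> K * norm (s *s x - ?A *v x)" if s: "0 \<le> Re s" for s x
  proof (cases "norm s \<le> a + 1")
    case True
    show ?thesis
    proof (cases "x = 0")
      case False
      define u where "u = of_real (inverse (norm x)) *s x"
      have x: "x = of_real (norm x) *s u" using False by (simp add: u_def flip: of_real_mult)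
      have "norm u = 1" using False by (simp add: u_def norm_smult_vec norm_inverse)
      then have "m \<le> norm (s *s u - ?A *v u)"
        using z(2)[of "(s, u)"] True s by (simp add: m_def S_def U_def)
      then have "norm x * m \<le> norm x * norm (s *s u - ?A *v u)" by (intro mult_left_mono) auto
      also have "\<dots> = norm (of_real (norm x) *s (s *s u - ?A *v u))" by (subst norm_smult_vec) simp
      also have "of_real (norm x) *s (s *s u - ?A *v u) = s *s x - ?A *v x"
        using lin[of s "of_real (norm x)" u] unfolding x[symmetric] by (rule sym)
      finally have "norm x \<le> 1 / m * norm (s *s x - ?A *v x)" using \<open>0 < m\<close> by (simp add: field_simps)
      also have "\<dots> \<le> K * norm (s *s x - ?A *v x)" by (intro mult_right_mono) (auto simp: K_def)
      finally show ?thesis .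
    qed (simp add: K_def)
  next
    case False
    have "(a + 1) * norm x \<le> norm s * norm x" using False by (intro mult_right_mono) auto
    moreover have "norm (s *s x) - norm (?A *v x) \<le> norm (s *s x - ?A *v x)" by (rule norm_triangle_ineq2)
    moreover have "norm (?A *v x) \<le> a * norm x" unfolding a_def by (rule norm_mult_vec_le)
    ultimately have "norm x \<le> 1 * norm (s *s x - ?A *v x)" by (simp add: norm_smult_vec algebra_simps)
    also have "\<dots> \<le> K * norm (s *s x - ?A *v x)" by (intro mult_right_mono) (auto simp: K_def)
    finally show ?thesis .
  qed
  moreover have "0 < K" by (simp add: K_def)
  ultimately show ?thesis using that by blast
qed

text \<open>The resolvent bound makes the supremum that defines the norm one over a bounded set, so that it really is
  an upper bound.\<close>

lemma norm_transfer_le_hinf_norm: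
  assumes H: "stable_lti H" and s: "0 \<le> Re s"
  shows "norm (transfer H s *v w) \<le> hinf_norm H * norm w"
proof -
  let ?B = "cmat (lti_B H)" and ?C = "cmat (lti_C H)" and ?D = "cmat (lti_D H)"
  obtain K where K: "0 < K" "\<And>s x. 0 \<le> Re s \<Longrightarrow> norm x \<le> K * norm (s *s x - cmat (lti_A H) *v x)"
    using stable_lti_resolvent_bounded[OF H] by blast
  have nonneg: "0 \<le> spectral_norm M" for M :: "complex^'x^'y"
    unfolding spectral_norm_def by (intro onorm_pos_le matrix_vector_mul_bounded_linear)
  let ?K = "spectral_norm ?C * (K * spectral_norm ?B) + spectral_norm ?D"
  have "spectral_norm (transfer H s) \<le> ?K" if s: "0 \<le> Re s" for s
    unfolding spectral_norm_def[of "transfer H s"]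
  proof (rule onorm_le)
    fix w
    note inv = stable_lti_resolvent_invertible[OF H s]
    obtain x where x: "s *s x = cmat (lti_A H) *v x + ?B *v w"
      using transfer_output(2)[OF inv] by blast
    have "norm x \<le> K * norm (?B *v w)" using K(2)[OF s, of x] x by simp
    also have "\<dots> \<le> K * (spectral_norm ?B * norm w)"
      using K(1) by (intro mult_left_mono norm_mult_vec_le) auto
    finally have "spectral_norm ?C * norm x \<le> spectral_norm ?C * (K * (spectral_norm ?B * norm w))"
      by (intro mult_left_mono nonneg)
    moreover have "norm (transfer H s *v w) \<le> norm (?C *v x) + norm (?D *v w)"
      unfolding transfer_output(1)[OF inv x, symmetric] by (rule norm_triangle_ineq)
    moreover have "norm (?C *v x) \<le> spectral_norm ?C * norm x" "norm (?D *v w) \<le> spectral_norm ?D * norm w"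
      by (rule norm_mult_vec_le)+
    ultimately show "norm (transfer H s *v w) \<le> ?K * norm w"
      by (simp add: algebra_simps)
  qed
  then have "bdd_above ((\<lambda>s. spectral_norm (transfer H s)) ` {s. 0 \<le> Re s})"
    by (intro bdd_aboveI2) auto
  then have "spectral_norm (transfer H s) \<le> hinf_norm H"
    unfolding hinf_norm_def using s by (intro cSUP_upper) auto
  then have "spectral_norm (transfer H s) * norm w \<le> hinf_norm H * norm w"
    by (intro mult_right_mono) auto
  then show ?thesis using norm_mult_vec_le[of "transfer H s" w] by linarith
qed

lemma hinf_norm_nonneg:
  fixes H :: "('n::finite, 'm::finite, 'p::finite) lti"
  assumes "stable_lti H" shows "0 \<le> hinf_norm H"
proof -
  let ?e = "axis undefined 1 :: complex^'m"
  have "0 \<le> hinf_norm H * norm ?e"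
    by (rule order_trans[OF norm_ge_zero norm_transfer_le_hinf_norm[OF assms, of 0]]) simp
  moreover have "0 < norm ?e" by (simp add: axis_eq_0_iff)
  ultimately show ?thesis by (simp add: zero_le_mult_iff)
qed

text \<open>Once around the loop the input satisfies \<open>|w| \<le> |k| |w|\<close>, so it vanishes. The states then solve the
  two autonomous stable systems and vanish as well.\<close>

lemma small_gain:
  assumes G: "stable_lti G" and \<Delta>: "stable_lti \<Delta>" and gain: "hinf_norm \<Delta> * hinf_norm G \<le> 1"
    and s: "0 \<le> Re s" and k: "norm k < 1" and mode: "loop_mode G \<Delta> s k x y w"
  shows "x = 0 \<and> y = 0 \<and> w = 0"
proof -
  note invG = stable_lti_resolvent_invertible[OF G s] and inv\<Delta> = stable_lti_resolvent_invertible[OF \<Delta> s]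
  define r where "r = cmat (lti_C G) *v x + cmat (lti_D G) *v w"
  have x: "s *s x = cmat (lti_A G) *v x + cmat (lti_B G) *v w"
    and y: "s *s y = cmat (lti_A \<Delta>) *v y + cmat (lti_B \<Delta>) *v r"
    and w: "w = k *s (cmat (lti_C \<Delta>) *v y + cmat (lti_D \<Delta>) *v r)"
    using mode by (simp_all add: loop_mode_def r_def)
  have r: "r = transfer G s *v w" unfolding r_def by (rule transfer_output(1)[OF invG x])
  have "norm w = norm k * norm (transfer \<Delta> s *v r)"
    by (subst w) (simp add: norm_smult_vec transfer_output(1)[OF inv\<Delta> y])
  also have "norm (transfer \<Delta> s *v r) \<le> hinf_norm \<Delta> * norm r"
    by (rule norm_transfer_le_hinf_norm[OF \<Delta> s])
  also have "\<dots> \<le> hinf_norm \<Delta> * (hinf_norm G * norm w)"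
    unfolding r using G s by (intro mult_left_mono norm_transfer_le_hinf_norm hinf_norm_nonneg \<Delta>)
  also have "\<dots> \<le> 1 * norm w"
    unfolding mult.assoc[symmetric] by (intro mult_right_mono gain) auto
  finally have "norm w \<le> norm k * norm w" by (simp add: mult_left_mono)
  then have "w = 0" using k by (metis mult_less_cancel_right2 norm_le_zero_iff not_le)
  have kernel: "z = 0" if "stable_lti H" "s *s z = cmat (lti_A H) *v z" for z and H :: "('x::finite,'y::finite,'z::finite) lti"
    using that(1)[unfolded stable_lti_def, rule_format, of z s] that(2) s by force
  have "x = 0" using x \<open>w = 0\<close> by (intro kernel[OF G]) simp
  moreover have "y = 0" using y r \<open>w = 0\<close> by (intro kernel[OF \<Delta>]) simp
  ultimately show ?thesis using \<open>w = 0\<close> by simp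
qed

lemma critical_frequency_loop_mode:
  assumes "stable_lti G" "stable_lti \<Delta>" "0 \<le> Re s"
    and "det (mat 1 - transfer \<Delta> s ** transfer G s) = 0"
  shows "\<exists>x y w. w \<noteq> 0 \<and> loop_mode G \<Delta> s 1 x y w"
proof -
  note invG = stable_lti_resolvent_invertible[OF assms(1,3)] and inv\<Delta> = stable_lti_resolvent_invertible[OF assms(2,3)]
  obtain w where w: "w \<noteq> 0" "(mat 1 - transfer \<Delta> s ** transfer G s) *v w = 0"
    using assms(4) unfolding det_eq_0_iff_kernel by blast
  obtain x where x: "s *s x = cmat (lti_A G) *v x + cmat (lti_B G) *v w"
    using transfer_output(2)[OF invG] by blast
  define r where "r = cmat (lti_C G) *v x + cmat (lti_D G) *v w"
  obtain y where y: "s *s y = cmat (lti_A \<Delta>) *v y + cmat (lti_B \<Delta>) *v r"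
    using transfer_output(2)[OF inv\<Delta>] by blast
  have "w = transfer \<Delta> s *v (transfer G s *v w)"
    using w(2) by (simp add: matrix_vector_mult_diff_rdistrib matrix_vector_mul_assoc)
  then have "w = cmat (lti_C \<Delta>) *v y + cmat (lti_D \<Delta>) *v r"
    using transfer_output(1)[OF invG x] transfer_output(1)[OF inv\<Delta> y] by (simp add: r_def)
  then have "loop_mode G \<Delta> s 1 x y w" using x y by (simp add: loop_mode_def r_def)
  then show ?thesis using w(1) by blast
qed

definition vRe :: "complex^'n \<Rightarrow> real^'n" where "vRe v = (\<chi> i. Re (v $ i))"
definition vIm :: "complex^'n \<Rightarrow> real^'n" where "vIm v = (\<chi> i. Im (v $ i))"

lemma vRe_vIm_eq_0_iff: "v = 0 \<longleftrightarrow> vRe v = 0 \<and> vIm v = 0"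
  by (auto simp: vec_eq_iff vRe_def vIm_def complex_eq_iff)

lemma vRe_0 [simp]: "vRe 0 = 0" and vIm_0 [simp]: "vIm 0 = 0"
  using vRe_vIm_eq_0_iff by auto

lemma vRe_add [simp]: "vRe (u + v) = vRe u + vRe v" and vIm_add [simp]: "vIm (u + v) = vIm u + vIm v"
  by (simp_all add: vec_eq_iff vRe_def vIm_def)

lemma vRe_smult: "vRe (c *s v) = Re c *\<^sub>R vRe v - Im c *\<^sub>R vIm v"
  and vIm_smult: "vIm (c *s v) = Im c *\<^sub>R vRe v + Re c *\<^sub>R vIm v"
  by (simp_all add: vec_eq_iff vRe_def vIm_def)

lemma vRe_cmat [simp]: "vRe (cmat M *v v) = M *v vRe v" and vIm_cmat [simp]: "vIm (cmat M *v v) = M *v vIm v"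
  by (simp_all add: vec_eq_iff vRe_def vIm_def cmat_def map_matrix_def matrix_vector_mult_def)

lemma lin_closed_loop_eq:
  assumes "lin_well_posed G \<Delta>"
    and w: "w = lti_C \<Delta> *v y + lti_D \<Delta> *v (lti_C G *v x + lti_D G *v w)"
  shows "lin_closed_loop G \<Delta> (x, y) =
    (lti_A G *v x + lti_B G *v w, lti_A \<Delta> *v y + lti_B \<Delta> *v (lti_C G *v x + lti_D G *v w))"
proof -
  let ?M = "mat 1 - lti_D \<Delta> ** lti_D G"
  have inv: "invertible ?M" using assms(1) by (simp add: lin_well_posed_def invertible_det_nz)
  have "?M *v w = lti_D \<Delta> *v (lti_C G *v x) + lti_C \<Delta> *v y"
    using w by (simp add: matrix_vector_mult_diff_rdistrib matrix_vector_mul_assoc[symmetric]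
        matrix_vector_right_distrib algebra_simps)
  then have "matrix_inv ?M *v (lti_D \<Delta> *v (lti_C G *v x) + lti_C \<Delta> *v y) = w"
    using matrix_inv_mult_vec(2)[OF inv, of w] by simp
  then show ?thesis by (simp add: lin_closed_loop_def Let_def)
qed

text \<open>For a real gain a complex mode is turned into a real invariant plane of the closed loop, spanned by the real and
  imaginary parts of its state. The mode cannot live in the input alone because of well-posedness.\<close>

lemma loop_mode_real_eigenplane:
  assumes mode: "loop_mode G \<Delta> s (of_real k) x y w" and nz: "x \<noteq> 0 \<or> y \<noteq> 0 \<or> w \<noteq> 0"
    and wp: "lin_well_posed G (scale_lti k \<Delta>)"
  defines "p \<equiv> (vRe x, vRe y)" and "q \<equiv> (vIm x, vIm y)" and "T \<equiv> lin_closed_loop G (scale_lti k \<Delta>)"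
  shows "T p = Re s *\<^sub>R p - Im s *\<^sub>R q" "T q = Im s *\<^sub>R p + Re s *\<^sub>R q" "p \<noteq> 0 \<or> q \<noteq> 0"
proof -
  note m = mode[unfolded loop_mode_def]
  note mx = conjunct1[OF m] and my = conjunct1[OF conjunct2[OF m]] and mw = conjunct2[OF conjunct2[OF m]]
  have Re_w: "vRe w = lti_C (scale_lti k \<Delta>) *v vRe y + lti_D (scale_lti k \<Delta>) *v (lti_C G *v vRe x + lti_D G *v vRe w)"
    using arg_cong[OF mw, of vRe] 
    by (simp add: vRe_smult scale_lti_def scaleR_matrix_vector_assoc[symmetric] scaleR_add_right)
  have Im_w: "vIm w = lti_C (scale_lti k \<Delta>) *v vIm y + lti_D (scale_lti k \<Delta>) *v (lti_C G *v vIm x + lti_D G *v vIm w)"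
    using arg_cong[OF mw, of vIm] 
    by (simp add: vIm_smult scale_lti_def scaleR_matrix_vector_assoc[symmetric] scaleR_add_right)
  show "T p = Re s *\<^sub>R p - Im s *\<^sub>R q"
    unfolding T_def p_def q_def lin_closed_loop_eq[OF wp Re_w]
    using arg_cong[OF mx, of vRe] arg_cong[OF my, of vRe] by (simp add: vRe_smult scale_lti_def)
  show "T q = Im s *\<^sub>R p + Re s *\<^sub>R q"
    unfolding T_def p_def q_def lin_closed_loop_eq[OF wp Im_w]
    using arg_cong[OF mx, of vIm] arg_cong[OF my, of vIm] by (simp add: vIm_smult scale_lti_def)
  have "x \<noteq> 0 \<or> y \<noteq> 0"
  proof (rule ccontr)
    assume "\<not> (x \<noteq> 0 \<or> y \<noteq> 0)"
    then have xy: "x = 0" "y = 0" by blast+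
    let ?M = "mat 1 - lti_D (scale_lti k \<Delta>) ** lti_D G"
    have ker: "v = 0" if "?M *v v = 0" for v
      using wp that det_eq_0_iff_kernel[of ?M] by (auto simp: lin_well_posed_def)
    have M: "?M *v v = v - lti_D (scale_lti k \<Delta>) *v (lti_D G *v v)" for v
      by (simp add: matrix_vector_mult_diff_rdistrib matrix_vector_mul_assoc[symmetric])
    have "?M *v vRe w = 0"
      unfolding M using Re_w[unfolded xy] by simp
    moreover have "?M *v vIm w = 0"
      unfolding M using Im_w[unfolded xy] by simp
    ultimately have "w = 0" unfolding vRe_vIm_eq_0_iff[of w] using ker by blast
    then show False using nz xy by simp
  qed
  then show "p \<noteq> 0 \<or> q \<noteq> 0"
    unfolding p_def q_def vRe_vIm_eq_0_iff[of x] vRe_vIm_eq_0_iff[of y]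
    by (auto simp only: prod_eq_iff fst_conv snd_conv fst_zero snd_zero)
qed

lemma bounded_linear_lin_closed_loop: "bounded_linear (lin_closed_loop G \<Delta>)"
  unfolding lin_closed_loop_def Let_def case_prod_unfold
  by (intro bounded_linear_Pair bounded_linear_add bounded_linear_fst bounded_linear_snd
      bounded_linear_compose[OF matrix_vector_mul_bounded_linear])

lemma scale_lti_1 [simp]: "scale_lti 1 \<Delta> = \<Delta>"
  by (simp add: scale_lti_def)

lemma lti_simps_scale [simp]:
  "lti_A (scale_lti c \<Delta>) = lti_A \<Delta>" "lti_B (scale_lti c \<Delta>) = lti_B \<Delta>"
  "lti_C (scale_lti c \<Delta>) = c *\<^sub>R lti_C \<Delta>" "lti_D (scale_lti c \<Delta>) = c *\<^sub>R lti_D \<Delta>"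
  by (simp_all add: scale_lti_def)

text \<open>Well-posedness turns modes into eigenvectors of a bounded operator, and its norm bounds the exponents. This
  shows that the characteristic polynomial at gain 1 is not identically zero in \<open>s\<close>.\<close>

lemma no_large_real_loop_mode:
  fixes G :: "('n::finite, 'm::finite, 'p::finite) lti" and \<Delta> :: "('k::finite, 'p, 'm) lti"
  assumes wp: "lin_well_posed G \<Delta>"
  obtains s where "\<And>x y w. loop_mode G \<Delta> s 1 x y w \<Longrightarrow> x = 0 \<and> y = 0 \<and> w = 0"
proof -
  let ?T = "lin_closed_loop G \<Delta>"
  obtain K where K: "0 < K" "\<And>z. norm (?T z) \<le> norm z * K"
    using bounded_linear.pos_bounded[OF bounded_linear_lin_closed_loop] by blast
  have small: "z = 0" if "?T z = (K + 1) *\<^sub>R z" for z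
  proof (rule ccontr)
    assume "z \<noteq> 0"
    moreover have "(K + 1) * norm z \<le> norm z * K" using K(2)[of z] K(1) that by simp
    ultimately show False by (simp add: algebra_simps)
  qed
  have "x = 0 \<and> y = 0 \<and> w = 0" if "loop_mode G \<Delta> (of_real (K + 1)) 1 x y w" for x y w
  proof (rule ccontr)
    assume "\<not> ?thesis"
    then have nz: "x \<noteq> 0 \<or> y \<noteq> 0 \<or> w \<noteq> 0" by blast
    have mode: "loop_mode G \<Delta> (of_real (K + 1)) (of_real 1) x y w" using that by simp
    have wp1: "lin_well_posed G (scale_lti 1 \<Delta>)" using wp by simp
    note plane = loop_mode_real_eigenplane[OF mode nz wp1]
    show False using plane small by auto
  qed
  then show ?thesis using that by blast
qed

lemma unstable_loop_modes:
  fixes G :: "('n::finite, 'm::finite, 'p::finite) lti" and \<Delta> :: "('k::finite, 'p, 'm) lti"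
  assumes G: "stable_lti G" and attack: "minimal_destabilizing_attack G \<Delta>" and wp: "lin_well_posed G \<Delta>"
  shows "\<forall>\<^sub>F \<epsilon> in at_right (0::real). \<exists>s x y w. 0 < Re s \<and> (x \<noteq> 0 \<or> y \<noteq> 0 \<or> w \<noteq> 0) \<and>
    loop_mode G \<Delta> s (of_real (1 + \<epsilon>)) x y w"
proof -
  have \<Delta>: "stable_lti \<Delta>" and gain: "hinf_norm \<Delta> * hinf_norm G \<le> 1"
    using attack by (auto simp: minimal_destabilizing_attack_def)
  obtain \<omega> :: real where \<omega>: "det (mat 1 - transfer \<Delta> (\<i> * of_real \<omega>) ** transfer G (\<i> * of_real \<omega>)) = 0"
    using attack by (auto simp: minimal_destabilizing_attack_def)
  obtain p where p: "\<And>s k. bieval p s k = 0 \<longleftrightarrow>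
      (\<exists>x y w. (x \<noteq> 0 \<or> y \<noteq> 0 \<or> w \<noteq> 0) \<and> loop_mode G \<Delta> s k x y w)"
    by (rule characteristic_bipolynomial_of_loop[of G \<Delta>]) (rule that)
  obtain s1 where s1: "\<And>x y w. loop_mode G \<Delta> s1 1 x y w \<Longrightarrow> x = 0 \<and> y = 0 \<and> w = 0"
    by (rule no_large_real_loop_mode[OF wp]) (rule that)
  have "\<forall>\<^sub>F \<epsilon> in at_right (0::real). \<exists>s. 0 < Re s \<and> bieval p s (1 + of_real \<epsilon>) = 0"
  proof (rule root_crosses_imaginary_axis)
    show "bieval p s k \<noteq> 0" if "0 \<le> Re s" "norm k < 1" for s k
      unfolding p using small_gain[OF G \<Delta> gain that] by blast
    show "bieval p (\<i> * of_real \<omega>) 1 = 0"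
      unfolding p using critical_frequency_loop_mode[OF G \<Delta> _ \<omega>] by auto
    show "bieval p s1 1 \<noteq> 0" unfolding p using s1 by blast
  qed simp
  then show ?thesis unfolding p by (rule eventually_mono) auto
qed

section \<open>Global solutions of Lipschitz differential equations\<close>

lemma has_vector_derivative_integral_from_0:
  fixes h :: "real \<Rightarrow> 'a::banach"
  assumes "continuous_on {0..} h" "0 \<le> t"
  shows "((\<lambda>u. integral {0..u} h) has_vector_derivative h t) (at t within {0..})"
proof -
  have "((\<lambda>u. integral {0..u} h) has_vector_derivative h t) (at t within {0..t+1})"
    using assms by (intro integral_has_vector_derivative continuous_on_subset[OF assms(1)]) auto
  moreover have "at t within {0..t+1} = at t within {0..}"
    using assms by (intro at_within_nhd[where S="{..<t+1}"]) auto
  ultimately show ?thesis by simp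
qed

text \<open>Picard iteration for \<open>u(t) = e\<^sup>-\<^sup>2\<^sup>L\<^sup>t x(t)\<close>. The weight turns the Lipschitz constant \<open>L\<close> into the contraction factor
  \<open>1/2\<close> on the whole half-line at once, so no continuation of local solutions is needed.\<close>

lemma global_solution_exists:
  fixes F :: "'a::banach \<Rightarrow> 'a"
  assumes lip: "\<And>x y. norm (F x - F y) \<le> L * norm (x - y)" and L: "0 < L"
  obtains x where "x 0 = x0" "solves_ode (\<lambda>_. F) x {0..}"
proof -
  define G where "G u s = F (exp (2*L * s) *\<^sub>R u s)" for u :: "real \<Rightarrow> 'a" and s
  \<comment> \<open>on negative times the iterate is held at its value for \<open>t = 0\<close>, to have functions on all of the real line\<close>
  define \<Phi> where "\<Phi> u t = exp (- (2*L*max 0 t)) *\<^sub>R (x0 + integral {0..max 0 t} (G u))"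
    for u and t :: real
  have contF: "continuous_on S F" for S
    by (rule lipschitz_on_continuous_on[of L], rule lipschitz_onI)
       (use lip L in \<open>auto simp: dist_norm\<close>)
  have contG: "continuous_on S (G u)" if "continuous_on UNIV u" for u S
    unfolding G_def using that
    by (intro continuous_on_compose2[OF contF[of UNIV]] continuous_intros)
       (auto intro: continuous_on_subset)
  have intG: "G u integrable_on {0..t}" if "continuous_on UNIV u" for u t
    by (intro integrable_continuous_real contG that)
  have exp_int: "((\<lambda>s. K * exp (2*L * s)) has_integral K * (exp (2*L*t) - 1) / (2*L)) {0..t}"
    if "0 \<le> t" for K t
  proof -
    have "((\<lambda>s. K * exp (2*L * s)) has_integral K * exp (2*L*t) / (2*L) - K * exp (2*L*0) / (2*L)) {0..t}"
      using that L
      by (intro fundamental_theorem_of_calculus)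
         (auto intro!: derivative_eq_intros simp: has_real_derivative_iff_has_vector_derivative[symmetric])
    then show ?thesis by (simp add: diff_divide_distrib right_diff_distrib)
  qed
  have weighted: "norm (exp (- (2*L*t)) *\<^sub>R integral {0..t} h) \<le> K / (2*L)"
    if "0 \<le> t" "0 \<le> K" "h integrable_on {0..t}" "\<And>s. 0 \<le> s \<Longrightarrow> norm (h s) \<le> K * exp (2*L * s)" for t K and h :: "real \<Rightarrow> 'a"
  proof -
    have "norm (integral {0..t} h) \<le> integral {0..t} (\<lambda>s. K * exp (2*L * s))"
      using that exp_int[of t K] by (intro integral_norm_bound_integral) auto
    also have "\<dots> = K * (exp (2*L*t) - 1) / (2*L)"
      using exp_int[OF that(1)] by (rule integral_unique)
    also have "\<dots> \<le> K * exp (2*L*t) / (2*L)"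
      using L that by (intro divide_right_mono mult_left_mono) auto
    finally have "exp (- (2*L*t)) * norm (integral {0..t} h) \<le> exp (- (2*L*t)) * (K * exp (2*L*t) / (2*L))"
      by (intro mult_left_mono) auto
    also have "\<dots> = K / (2*L)" by (simp add: exp_minus)
    finally show ?thesis by simp
  qed
  have Phi_bcont: "\<Phi> (apply_bcontfun u) \<in> bcontfun" for u :: "real \<Rightarrow>\<^sub>C 'a"
  proof (rule bcontfun_normI)
    have "continuous_on {0..} (\<lambda>t. integral {0..t} (G u))"
      unfolding continuous_on_eq_continuous_within
      by (intro ballI has_vector_derivative_continuous[OF has_vector_derivative_integral_from_0] contG) auto
    then have "continuous_on UNIV (\<lambda>t. integral {0..max 0 t} (G u))"
      by (rule continuous_on_compose2) (auto intro!: continuous_intros)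
    then show "continuous_on UNIV (\<Phi> u)" unfolding \<Phi>_def by (intro continuous_intros)
    fix t :: real
    let ?t = "max 0 t" and ?K = "norm (F 0) + L * norm u"
    have "norm (G u s) \<le> ?K * exp (2*L * s)" if "0 \<le> s" for s
    proof -
      have "norm (G u s) \<le> norm (F 0) + norm (F (exp (2*L * s) *\<^sub>R u s) - F 0)"
        unfolding G_def by norm
      also have "\<dots> \<le> norm (F 0) * 1 + L * (exp (2*L * s) * norm u)"
        using lip[of "exp (2*L * s) *\<^sub>R u s" 0] L norm_bounded[of u s]
        by (smt (verit, best) abs_exp_cancel diff_zero mult_left_mono norm_scaleR exp_ge_zero mult.right_neutral)
      also have "\<dots> \<le> norm (F 0) * exp (2*L * s) + L * (exp (2*L * s) * norm u)"
        using L that by (intro add_right_mono mult_left_mono) auto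
      finally show ?thesis by (simp add: algebra_simps)
    qed
    then have "norm (exp (- (2*L*?t)) *\<^sub>R integral {0..?t} (G u)) \<le> ?K / (2*L)"
      using L by (intro weighted intG) (auto intro!: add_nonneg_nonneg)
    moreover have "norm (exp (- (2*L*?t)) *\<^sub>R x0) \<le> norm x0"
      using L by (simp add: mult_left_le_one_le)
    ultimately show "norm (\<Phi> u t) \<le> norm x0 + ?K / (2*L)"
      unfolding \<Phi>_def scaleR_add_right by (intro norm_triangle_le add_mono)
  qed
  have contraction: "norm (\<Phi> u t - \<Phi> v t) \<le> 1/2 * dist u v" for u v :: "real \<Rightarrow>\<^sub>C 'a" and t
  proof -
    let ?t = "max 0 t"
    have "norm (G u s - G v s) \<le> L * dist u v * exp (2*L * s)" if "0 \<le> s" for s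
    proof -
      have "norm (G u s - G v s) \<le> L * norm (exp (2*L * s) *\<^sub>R u s - exp (2*L * s) *\<^sub>R v s)"
        unfolding G_def by (rule lip)
      also have "\<dots> = L * (exp (2*L * s) * dist (u s) (v s))"
        by (simp add: dist_norm flip: scaleR_diff_right)
      also have "\<dots> \<le> L * (exp (2*L * s) * dist u v)"
        using L dist_bounded by (intro mult_left_mono) auto
      finally show ?thesis by (simp add: algebra_simps)
    qed
    then have "norm (exp (- (2*L*?t)) *\<^sub>R integral {0..?t} (\<lambda>s. G u s - G v s)) \<le> L * dist u v / (2*L)"
      using L by (intro weighted integrable_diff intG) auto
    moreover have "\<Phi> u t - \<Phi> v t = exp (- (2*L*?t)) *\<^sub>R integral {0..?t} (\<lambda>s. G u s - G v s)"
      unfolding \<Phi>_def by (subst integral_diff) (auto intro!: intG simp: algebra_simps)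
    ultimately show ?thesis using L by simp
  qed
  have "\<exists>!u. Bcontfun (\<Phi> (apply_bcontfun u)) = u"
  proof (rule banach_fix_type[where c="1/2"])
    show "\<forall>u v. dist (Bcontfun (\<Phi> (apply_bcontfun u))) (Bcontfun (\<Phi> (apply_bcontfun v))) \<le> 1/2 * dist u v"
      using contraction
      by (intro allI dist_bound) (simp only: Bcontfun_inverse[OF Phi_bcont] dist_norm[of "\<Phi> _ _"])
  qed auto
  then obtain u where "Bcontfun (\<Phi> (apply_bcontfun u)) = u" by blast
  then have fixp: "\<Phi> u = apply_bcontfun u" by (metis Bcontfun_inverse Phi_bcont)
  define x where "x t = exp (2*L*t) *\<^sub>R u t" for t
  have x_eq: "x t = x0 + integral {0..t} (\<lambda>s. F (x s))" if "0 \<le> t" for t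
  proof -
    have "x t = exp (2*L*t) *\<^sub>R \<Phi> u t" unfolding x_def fixp ..
    also have "\<dots> = x0 + integral {0..t} (G u)"
      using that by (simp add: \<Phi>_def flip: exp_add)
    finally show ?thesis unfolding G_def x_def .
  qed
  have "continuous_on {0..} (\<lambda>s. F (x s))"
    using contG[of u "{0..}"] unfolding G_def x_def by simp
  then have "((\<lambda>t. x0 + integral {0..t} (\<lambda>s. F (x s))) has_vector_derivative F (x t)) (at t within {0..})"
    if "0 \<le> t" for t
    using has_vector_derivative_add[OF has_vector_derivative_const
        has_vector_derivative_integral_from_0[OF _ that]] by force
  then have "solves_ode (\<lambda>_. F) x {0..}"
    unfolding solves_ode_def
    by (auto intro: has_vector_derivative_transform simp: x_eq)
  moreover have "x 0 = x0" using x_eq[of 0] by simp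
  ultimately show ?thesis using that by blast
qed

lemma solves_ode_subset:
  "solves_ode F x I \<Longrightarrow> J \<subseteq> I \<Longrightarrow> solves_ode F x J"
  unfolding solves_ode_def by (meson has_vector_derivative_within_subset subsetD)

lemma solves_ode_continuous_on: "solves_ode F x I \<Longrightarrow> continuous_on I x"
  unfolding solves_ode_def continuous_on_eq_continuous_within
  by (blast intro: has_vector_derivative_continuous)

text \<open>The field is made globally Lipschitz by composing it with the projection onto the ball. A solution of the modified
  equation solves the original one until it first reaches the sphere, and stability says that it never does.\<close>

lemma lyapunov_stable_global_solution_stays:
  fixes F :: "'a::euclidean_space \<Rightarrow> 'a"
  assumes stable: "lyapunov_stable F 0" and r: "0 < r"
    and lip: "L-lipschitz_on (cball 0 r) F"
  obtains \<delta> where "\<delta> > 0" "\<And>x0. norm x0 < \<delta> \<Longrightarrow>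
    \<exists>x. x 0 = x0 \<and> solves_ode (\<lambda>_. F) x {0..} \<and> (\<forall>t\<ge>0. norm (x t) < r)"
proof -
  define L' where "L' = max L 1"
  define proj where "proj = closest_point (cball (0::'a) r)"
  have proj_id: "proj z = z" if "norm z \<le> r" for z
    unfolding proj_def using that by (simp add: closest_point_self)
  have proj_in: "proj z \<in> cball 0 r" for z
    unfolding proj_def using r by (intro closest_point_in_set) auto
  have L': "0 < L'" "L'-lipschitz_on (cball 0 r) F"
    using lip by (auto simp: L'_def intro: lipschitz_on_le)
  have "norm (F (proj x) - F (proj y)) \<le> L' * norm (x - y)" for x y
  proof -
    have "norm (F (proj x) - F (proj y)) \<le> L' * dist (proj x) (proj y)"
      using lipschitz_onD[OF L'(2) proj_in proj_in, of x y] by (simp add: dist_norm)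
    also have "\<dots> \<le> L' * dist x y"
      unfolding proj_def using r L' by (intro mult_left_mono closest_point_lipschitz) auto
    finally show ?thesis by (simp add: dist_norm)
  qed
  note ex = global_solution_exists[of "\<lambda>z. F (proj z)", OF this L'(1)]
  obtain \<delta> where "\<delta> > 0" and \<delta>: "\<And>x T. solves_ode (\<lambda>_. F) x {0..T} \<Longrightarrow> norm (x 0) < \<delta> \<Longrightarrow>
      (\<forall>t\<in>{0..T}. norm (x t) < r)"
    using stable r unfolding lyapunov_stable_def by (metis diff_zero)
  have "\<exists>x. x 0 = x0 \<and> solves_ode (\<lambda>_. F) x {0..} \<and> (\<forall>t\<ge>0. norm (x t) < r)"
    if "norm x0 < min \<delta> r" for x0
  proof -
    obtain x where x0: "x 0 = x0" and x: "solves_ode (\<lambda>_. \<lambda>z. F (proj z)) x {0..}"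
      by (rule ex)
    note cont = solves_ode_continuous_on[OF x]
    have sol: "solves_ode (\<lambda>_. F) x I" if "I \<subseteq> {0..}" "\<forall>t\<in>I. norm (x t) \<le> r" for I
      using solves_ode_subset[OF x that(1)] that(2) by (auto simp: solves_ode_def proj_id)
    have inside: "norm (x t) < r" if "0 \<le> t" for t
    proof (rule ccontr)
      assume "\<not> norm (x t) < r"
      \<comment> \<open>\<open>s\<close> below is the first time at which the solution reaches the sphere\<close>
      define S where "S = {s \<in> {0..t}. r \<le> norm (x s)}"
      have "compact S"
      proof -
        have "continuous_on {0..t} (\<lambda>s. norm (x s))"
          by (intro continuous_intros continuous_on_subset[OF cont]) auto
        then have "closedin (top_of_set {0..t}) ({0..t} \<inter> (\<lambda>s. norm (x s)) -` {r..})"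
          by (rule continuous_closedin_preimage) auto
        moreover have "{0..t} \<inter> (\<lambda>s. norm (x s)) -` {r..} = S" by (auto simp: S_def)
        ultimately show ?thesis using closedin_compact by fastforce
      qed
      moreover have "S \<noteq> {}" using that \<open>\<not> norm (x t) < r\<close> by (auto simp: S_def)
      ultimately obtain s where s: "s \<in> S" "\<And>s'. s' \<in> S \<Longrightarrow> s \<le> s'"
        using compact_attains_inf[of S] by blast
      have before: "norm (x s') < r" if "0 \<le> s'" "s' < s" for s'
        using s(1) s(2)[of s'] that by (force simp: S_def)
      have "norm (x s) = r"
      proof (rule antisym)
        have "s \<noteq> 0" using s(1) x0 \<open>norm x0 < min \<delta> r\<close> by (auto simp: S_def)
        then have "0 < s" using s(1) by (auto simp: S_def)
        have "((\<lambda>s. norm (x s)) \<longlongrightarrow> norm (x s)) (at s within {0..s})"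
          using cont \<open>0 < s\<close> by (intro tendsto_norm tendsto_within_subset[of x _ s "{0..}" "{0..s}"])
            (auto simp: continuous_on_def)
        moreover have "at s within {0..s} = at s within {0..<s}"
          by (intro at_within_nhd[of _ UNIV]) auto
        moreover have "eventually (\<lambda>s'. norm (x s') \<le> r) (at s within {0..<s})"
          using before by (auto simp: eventually_at_filter less_imp_le)
        moreover have "at s within {0..<s} \<noteq> bot"
          using \<open>0 < s\<close> by (simp add: at_within_eq_bot_iff islimpt_Ico flip: trivial_limit_within)
        ultimately show "norm (x s) \<le> r" using tendsto_upperbound by simp
      qed (use s(1) in \<open>auto simp: S_def\<close>)
      then have "norm (x s') \<le> r" if "s' \<in> {0..s}" for s'
        using before[of s'] that by (cases "s' = s") auto
      then have "solves_ode (\<lambda>_. F) x {0..s}" by (intro sol) auto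
      then have "norm (x s) < r" using \<delta>[of x s] x0 \<open>norm x0 < min \<delta> r\<close> s(1)
        by (auto simp: S_def)
      then show False using \<open>norm (x s) = r\<close> by simp
    qed
    then show ?thesis using x0 sol[of "{0..}"] by (auto intro: less_imp_le)
  qed
  then show ?thesis using that[of "min \<delta> r"] \<open>\<delta> > 0\<close> r by simp
qed

section \<open>Instability from the linearization\<close>

text \<open>Applying \<open>S - a\<close> to a linear relation removes the eigenvector of \<open>a\<close> and scales the other coefficients by nonzero factors.\<close>

lemma eigenvectors_independent:
  fixes S :: "'a::real_vector \<Rightarrow> 'a" and e :: "real \<Rightarrow> 'a"
  assumes "linear S" "finite B"
    and "\<And>b. b \<in> B \<Longrightarrow> S (e b) = b *\<^sub>R e b" "\<And>b. b \<in> B \<Longrightarrow> e b \<noteq> 0"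
    and "(\<Sum>b\<in>B. c b *\<^sub>R e b) = 0" "b \<in> B"
  shows "c b = 0"
  using assms(2-)
proof (induction B arbitrary: c b rule: finite_induct)
  case (insert a B)
  let ?s = "\<lambda>c. \<Sum>b\<in>B. c b *\<^sub>R e b"
  have eq: "c a *\<^sub>R e a + ?s c = 0" using insert by simp
  have "S (c a *\<^sub>R e a + ?s c) = c a *\<^sub>R a *\<^sub>R e a + (\<Sum>b\<in>B. c b *\<^sub>R b *\<^sub>R e b)"
    using insert.prems(1) by (simp add: linear_add linear_scale linear_sum assms(1))
  then have "c a *\<^sub>R a *\<^sub>R e a + (\<Sum>b\<in>B. c b *\<^sub>R b *\<^sub>R e b) = 0"
    using eq assms(1) by (simp add: linear_0)
  moreover have "(\<Sum>b\<in>B. ((b - a) * c b) *\<^sub>R e b) =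
      (c a *\<^sub>R a *\<^sub>R e a + (\<Sum>b\<in>B. c b *\<^sub>R b *\<^sub>R e b)) - a *\<^sub>R (c a *\<^sub>R e a + ?s c)"
    by (simp add: algebra_simps scaleR_sum_right sum_subtractf)
  ultimately have "(\<Sum>b\<in>B. ((b - a) * c b) *\<^sub>R e b) = 0" using eq by simp
  from insert.IH[OF insert.prems(1,2) this] have *: "c b = 0" if "b \<in> B" for b
    using that insert.hyps by fastforce
  then have "c a *\<^sub>R e a = 0" using eq by simp
  then show ?case using * insert.prems by auto
qed simp

lemma non_eigenvalue_in_interval:
  fixes S :: "'a::euclidean_space \<Rightarrow> 'a" and a :: real
  assumes S: "linear S" and a: "0 < a"
  obtains b where "0 < b" "b < a" "\<And>x. S x = b *\<^sub>R x \<Longrightarrow> x = 0"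
proof (rule ccontr)
  assume "\<not> thesis"
  then have "\<forall>b\<in>{0<..<a}. \<exists>x. x \<noteq> 0 \<and> S x = b *\<^sub>R x"
    by (metis that greaterThanLessThan_iff)
  then obtain e where e: "\<And>b. b \<in> {0<..<a} \<Longrightarrow> e b \<noteq> 0 \<and> S (e b) = b *\<^sub>R e b" by metis
  obtain B where B: "B \<subseteq> {0<..<a}" "finite B" "card B = Suc DIM('a)"
    using infinite_arbitrarily_large[of "{0<..<a}" "Suc DIM('a)"] infinite_Ioo[OF a] by auto
  have inj: "inj_on e B"
  proof (rule inj_onI)
    fix x y assume "x \<in> B" "y \<in> B" "e x = e y"
    then have "x *\<^sub>R e x = y *\<^sub>R e x" "e x \<noteq> 0" using e B by (metis subsetD)+
    then show "x = y" by simp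
  qed
  have "independent (e ` B)"
  proof (rule independent_if_scalars_zero)
    fix f x assume 0: "(\<Sum>x\<in>e ` B. f x *\<^sub>R x) = 0" and "x \<in> e ` B"
    then obtain b where b: "b \<in> B" "x = e b" by auto
    have "(\<Sum>b\<in>B. f (e b) *\<^sub>R e b) = 0" using 0 by (simp add: sum.reindex[OF inj])
    have "f (e b) = 0"
      by (rule eigenvectors_independent[where c="\<lambda>b. f (e b)", OF S B(2) _ _ \<open>(\<Sum>b\<in>B. f (e b) *\<^sub>R e b) = 0\<close> b(1)])
         (use e B(1) in blast)+
    then show "f x = 0" using b by simp
  qed (use B in simp)
  then have "card (e ` B) \<le> DIM('a)" using independent_bound by blast
  then show False using B(3) by (simp add: card_image[OF inj])
qed

text \<open>The Sylvester operator \<open>X \<mapsto> M\<^sup>T X + X M - 2 \<beta> X\<close> is injective for some \<open>\<beta>\<close> in \<open>(0, a)\<close>, since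
  \<open>X \<mapsto> M\<^sup>T X + X M\<close> has only finitely many eigenvalues. It is then onto, and a preimage of the identity, made
  symmetric, gives \<open>Q\<close>. On the invariant plane of \<open>p\<close> and \<open>q\<close> the identity reads
  \<open>2 (a - \<beta>) (p\<^sup>T Q p + q\<^sup>T Q q) = |p|\<^sup>2 + |q|\<^sup>2\<close>, so the form is positive at one of the two.\<close>

lemma Chetaev_form_exists:
  fixes M :: "real^'d^'d" and p q :: "real^'d"
  assumes eig: "M *v p = a *\<^sub>R p - b *\<^sub>R q" "M *v q = b *\<^sub>R p + a *\<^sub>R q"
    and a: "0 < a" and nz: "p \<noteq> 0 \<or> q \<noteq> 0"
  obtains Q :: "real^'d^'d" and \<beta> z where "0 < \<beta>" "transpose Q = Q"
    "\<And>z. 2 * (z \<bullet> (Q *v (M *v z))) = 2 * \<beta> * (z \<bullet> (Q *v z)) + z \<bullet> z" "0 < z \<bullet> (Q *v z)"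
proof -
  define S where "S X = transpose M ** X + X ** M" for X :: "real^'d^'d"
  have S: "linear S"
    unfolding S_def by (rule linearI) (simp_all add: vec_eq_iff matrix_matrix_mult_def sum.distrib
      algebra_simps sum_distrib_left)
  \<comment> \<open>\<open>b'\<close> plays the role of \<open>2 \<beta>\<close>\<close>
  obtain b' where b': "0 < b'" "b' < 2 * a" "\<And>X. S X = b' *\<^sub>R X \<Longrightarrow> X = 0"
    using non_eigenvalue_in_interval[OF S, of "2*a"] a by auto
  have lin: "linear (\<lambda>X. S X - b' *\<^sub>R X)"
    by (intro linear_compose_sub S linear_scale_self)
  moreover have "inj (\<lambda>X. S X - b' *\<^sub>R X)"
    using b'(3) by (subst linear_injective_0[OF lin]) auto
  ultimately have "surj (\<lambda>X. S X - b' *\<^sub>R X)" by (rule linear_injective_imp_surjective) simp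
  then have "\<exists>X. mat 1 = S X - b' *\<^sub>R X" by (rule surjD)
  then obtain X where X: "S X - b' *\<^sub>R X = mat 1" by auto
  define Q where "Q = (1/2) *\<^sub>R (X + transpose X)"
  have symQ: "transpose Q = Q" unfolding Q_def by (simp add: transpose_def vec_eq_iff)
  have tr: "y \<bullet> (transpose Y *v z) = (Y *v y) \<bullet> z" for Y :: "real^'d^'d" and y z
    by (metis dot_lmul_matrix inner_commute transpose_matrix_vector)
  have Q: "y \<bullet> (Q *v z) = (y \<bullet> (X *v z) + (X *v y) \<bullet> z) / 2" for y z
    unfolding Q_def
    by (simp add: scaleR_matrix_vector_assoc[symmetric] matrix_vector_mult_add_rdistrib inner_add_right tr
      del: transpose_matrix_vector)
  have sym: "y \<bullet> (Q *v z) = z \<bullet> (Q *v y)" for y z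
    by (metis tr symQ inner_commute)
  have growth: "2 * (z \<bullet> (Q *v (M *v z))) = b' * (z \<bullet> (Q *v z)) + z \<bullet> z" for z
  proof -
    have "z \<bullet> ((transpose M ** X + X ** M - b' *\<^sub>R X) *v z) = z \<bullet> z"
      using X by (simp add: S_def)
    then have "(M *v z) \<bullet> (X *v z) + z \<bullet> (X *v (M *v z)) - b' * (z \<bullet> (X *v z)) = z \<bullet> z"
      by (simp add: matrix_vector_mult_add_rdistrib matrix_vector_mult_diff_rdistrib inner_add_right
          inner_diff_right tr scaleR_matrix_vector_assoc[symmetric] matrix_vector_mul_assoc[symmetric] del: transpose_matrix_vector)
    then show ?thesis by (simp add: Q inner_commute)
  qed
  have "2 * (p \<bullet> (Q *v (M *v p))) + 2 * (q \<bullet> (Q *v (M *v q))) = 2 * a * (p \<bullet> (Q *v p) + q \<bullet> (Q *v q))"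
    unfolding eig using sym[of p q]
    by (simp add: matrix_vector_mult_diff_distrib matrix_vector_right_distrib matrix_vector_mult_scaleR inner_diff_right
        inner_add_right algebra_simps)
  then have "(2 * a - b') * (p \<bullet> (Q *v p) + q \<bullet> (Q *v q)) = p \<bullet> p + q \<bullet> q"
    using growth[of p] growth[of q] by (simp add: algebra_simps)
  moreover have "p \<bullet> p + q \<bullet> q > 0"
    using nz by (metis add_nonneg_pos add_pos_nonneg inner_ge_zero inner_gt_zero_iff)
  ultimately have "p \<bullet> (Q *v p) + q \<bullet> (Q *v q) > 0"
    using b'(2) by (metis diff_gt_0_iff_gt zero_less_mult_pos)
  then have "\<exists>z. 0 < z \<bullet> (Q *v z)" by (metis add_nonpos_nonpos linorder_not_less)
  then show ?thesis using that[of "b'/2" Q] b'(1) symQ growth by auto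
qed

text \<open>Near the origin the nonlinear remainder costs at most \<open>c |z|\<^sup>2\<close> in the derivative of \<open>V\<close>, so \<open>e\<^sup>-\<^sup>2\<^sup>\<beta>\<^sup>t V\<close> does
  not decrease along solutions that stay there. A solution starting close to the origin with \<open>V > 0\<close> cannot
  stay, because \<open>V\<close> is bounded on the ball.\<close>

lemma Chetaev_instability:
  fixes F :: "'a::euclidean_space \<Rightarrow> 'a" and V :: "'a \<Rightarrow> 'a \<Rightarrow> real"
  assumes F0: "F 0 = 0" and r: "0 < r" and lip: "L-lipschitz_on (cball 0 r) F"
    and der: "(F has_derivative T) (at 0)"
    and bil: "bounded_bilinear V" and sym: "\<And>x y. V x y = V y x"
    and \<beta>: "0 < \<beta>" and c: "0 < c"
    and growth: "\<And>z. 2 * V z (T z) \<ge> 2 * \<beta> * V z z + c * (norm z)\<^sup>2"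
    and p: "0 < V p p"
  shows "\<not> lyapunov_stable F 0"
proof
  assume stable: "lyapunov_stable F 0"
  interpret V: bounded_bilinear V by fact
  obtain K where K: "0 < K" "\<And>x y. norm (V x y) \<le> norm x * norm y * K"
    using V.pos_bounded by blast
  have T0: "T 0 = 0" using der has_derivative_linear linear_0 by blast
  obtain d where d: "0 < d" "\<And>z. norm z < d \<Longrightarrow> norm (F z - T z) \<le> c / (2*K) * norm z"
    using der c K unfolding has_derivative_at_alt
    by (metis F0 T0 diff_zero divide_pos_pos mult_pos_pos zero_less_numeral)
  define \<eta> where "\<eta> = min r (d/2)"
  have \<eta>: "0 < \<eta>" "\<eta> \<le> r" "\<eta> < d" using r d(1) by (auto simp: \<eta>_def)
  have growth_F: "2 * V z (F z) \<ge> 2 * \<beta> * V z z" if "norm z < \<eta>" for z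
  proof -
    have "\<bar>V z (F z - T z)\<bar> \<le> norm z * norm (F z - T z) * K" using K(2) by (metis real_norm_def)
    also have "\<dots> \<le> norm z * (c / (2*K) * norm z) * K"
      using d(2)[of z] that \<eta> K(1) by (intro mult_right_mono mult_left_mono) auto
    also have "\<dots> = c * (norm z)\<^sup>2 / 2" using K(1) by (simp add: field_simps power2_eq_square)
    finally have "V z (T z) - V z (F z) \<le> c * (norm z)\<^sup>2 / 2"
      unfolding V.diff_right by linarith
    then show ?thesis using growth[of z] by simp
  qed
  have "L-lipschitz_on (cball 0 \<eta>) F"
    using lip \<eta>(2) by (auto intro: lipschitz_on_subset)
  then obtain \<delta> where \<delta>: "\<delta> > 0" "\<And>x0. norm x0 < \<delta> \<Longrightarrow>
    \<exists>x. x 0 = x0 \<and> solves_ode (\<lambda>_. F) x {0..} \<and> (\<forall>t\<ge>0. norm (x t) < \<eta>)"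
    using lyapunov_stable_global_solution_stays[OF stable \<eta>(1)] by blast
  have "p \<noteq> 0" using p V.zero_left by auto
  define z0 where "z0 = (\<delta> / (2 * norm p)) *\<^sub>R p"
  have "norm z0 < \<delta>" using \<open>p \<noteq> 0\<close> \<delta>(1) by (simp add: z0_def)
  then obtain x where x: "x 0 = z0" "solves_ode (\<lambda>_. F) x {0..}" "\<And>t. 0 \<le> t \<Longrightarrow> norm (x t) < \<eta>"
    using \<delta>(2) by blast
  have pos0: "0 < V z0 z0"
    using p \<open>p \<noteq> 0\<close> \<delta>(1) by (simp add: z0_def V.scaleR_left V.scaleR_right)
  have dV: "((\<lambda>t. V (x t) (x t)) has_vector_derivative 2 * V (x t) (F (x t))) (at t within {0..})"
    if "0 \<le> t" for t
  proof -
    have "(x has_vector_derivative F (x t)) (at t within {0..})"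
      using x(2) that by (simp add: solves_ode_def)
    from V.has_vector_derivative[OF this this] show ?thesis by (simp add: sym)
  qed
  define W where "W t = exp (- (2*\<beta>*t)) * V (x t) (x t)" for t
  have dW: "(W has_real_derivative
      exp (- (2*\<beta>*t)) * (2 * V (x t) (F (x t)) - 2*\<beta>* V (x t) (x t))) (at t within {0..})"
    if "0 \<le> t" for t
    unfolding W_def
    by (rule derivative_eq_intros dV[OF that, folded has_real_derivative_iff_has_vector_derivative] refl)+
       (simp add: algebra_simps)
  have mono: "W 0 \<le> W t" if "0 \<le> t" for t
  proof -
    have "(W has_vector_derivative
        exp (- (2*\<beta> * s)) * (2 * V (x s) (F (x s)) - 2*\<beta>* V (x s) (x s))) (at s within {0..t})"
      if "s \<in> {0..t}" for s
      using dW[of s] that by (auto simp flip: has_real_derivative_iff_has_vector_derivative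
          intro: DERIV_subset)
    from fundamental_theorem_of_calculus[OF \<open>0 \<le> t\<close> this]
    show ?thesis
      using growth_F[OF x(3)] by (auto dest!: has_integral_nonneg)
  qed
  \<comment> \<open>\<open>u\<close> is the ratio of the bound for \<open>V\<close> to its initial value, and \<open>u < e\<^sup>u\<close>: time \<open>u / (2 \<beta>)\<close> is late enough\<close>
  define u where "u = \<eta>\<^sup>2 * K / V z0 z0"
  have "0 \<le> u" using K(1) pos0 by (simp add: u_def)
  have "V z0 z0 \<le> exp (- u) * V (x (u / (2*\<beta>))) (x (u / (2*\<beta>)))"
    using mono[of "u / (2*\<beta>)"] \<open>0 \<le> u\<close> \<beta> x(1) by (simp add: W_def)
  also have "\<dots> \<le> exp (- u) * (\<eta>\<^sup>2 * K)"
  proof (intro mult_left_mono)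
    let ?z = "x (u / (2*\<beta>))"
    have "V ?z ?z \<le> (norm ?z)\<^sup>2 * K"
      using K(2)[of ?z ?z] by (simp add: power2_eq_square)
    also have "\<dots> \<le> \<eta>\<^sup>2 * K"
      using x(3)[of "u / (2*\<beta>)"] K(1) \<open>0 \<le> u\<close> \<beta> by (intro mult_right_mono power_mono) auto
    finally show "V ?z ?z \<le> \<eta>\<^sup>2 * K" .
  qed simp
  also have "\<dots> = exp (- u) * u * V z0 z0" using pos0 by (simp add: u_def)
  also have "\<dots> < 1 * V z0 z0"
  proof (intro mult_strict_right_mono pos0)
    have "u < exp u" using exp_ge_add_one_self[of u] by linarith
    then show "exp (- u) * u < 1" by (simp add: exp_minus field_simps)
  qed
  finally show False by simp
qed

lemma inner_vjoin: "vjoin x y \<bullet> vjoin x' y' = x \<bullet> x' + y \<bullet> y'" for x x' :: "real^'n" and y y' :: "real^'m"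
  by (simp add: inner_vec_def sum_UNIV_sum)

text \<open>Lyapunov's indirect method, with the Chetaev function of the derivative at the origin. The product space is identified
  isometrically with a space of column vectors, where the quadratic form comes from a matrix.\<close>

theorem linearized_instability:
  fixes F :: "(real^'n) \<times> (real^'k) \<Rightarrow> (real^'n) \<times> (real^'k)"
  assumes F0: "F 0 = 0" and r: "0 < r" and lip: "L-lipschitz_on (cball 0 r) F"
    and der: "(F has_derivative T) (at 0)"
    and eig: "T p = a *\<^sub>R p - b *\<^sub>R q" "T q = b *\<^sub>R p + a *\<^sub>R q" "p \<noteq> 0 \<or> q \<noteq> 0" and a: "0 < a"
  shows "\<not> lyapunov_stable F 0"
proof -
  define J where "J z = vjoin (fst z) (snd z)" for z :: "(real^'n) \<times> (real^'k)"
  define J' where "J' v = ((\<chi> i. v $ Inl i), (\<chi> i. v $ Inr i))" for v :: "real^('n + 'k)"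
  have J: "linear J"
    by (rule linearI) (simp_all add: J_def vec_sum_eq_iff)
  have J': "linear J'"
    by (rule linearI) (simp_all add: J'_def vec_eq_iff)
  have J'J: "J' (J z) = z" for z by (simp add: J_def J'_def)
  have inner_J: "J z \<bullet> J z' = z \<bullet> z'" for z z'
    by (simp add: J_def inner_vjoin inner_prod_def)
  have T: "linear T" using der has_derivative_linear by blast
  define M where "M = matrix (J \<circ> T \<circ> J')"
  have M: "M *v J z = J (T z)" for z
    unfolding M_def using linear_compose[OF J' linear_compose[OF T J]]
    by (simp add: matrix_works comp_assoc J'J)
  have J0: "J z \<noteq> 0" if "z \<noteq> 0" for z
    using that J'J[of z] linear_0[OF J'] by metis
  have MJ: "M *v J p = a *\<^sub>R J p - b *\<^sub>R J q" "M *v J q = b *\<^sub>R J p + a *\<^sub>R J q"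
    unfolding M eig(1,2) by (simp_all add: linear_diff[OF J] linear_add[OF J] linear_scale[OF J])
  have nzJ: "J p \<noteq> 0 \<or> J q \<noteq> 0" using eig(3) J0 by blast
  obtain Q :: "real^('n + 'k)^('n + 'k)" and \<beta> u where Q: "0 < \<beta>" "transpose Q = Q"
    "\<And>z. 2 * (z \<bullet> (Q *v (M *v z))) = 2 * \<beta> * (z \<bullet> (Q *v z)) + z \<bullet> z" "0 < u \<bullet> (Q *v u)"
    using Chetaev_form_exists[OF MJ a nzJ] by metis
  define V where "V z z' = J z \<bullet> (Q *v J z')" for z z'
  have JJ': "J (J' v) = v" for v by (simp add: J_def J'_def vec_sum_eq_iff)
  have blJ: "bounded_linear J" using J by (rule linear_conv_bounded_linear[THEN iffD1])
  show ?thesis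
  proof (rule Chetaev_instability[OF F0 r lip der, where V=V and c=1 and \<beta>=\<beta> and p="J' u"])
    show "bounded_bilinear V"
      unfolding V_def
      by (intro bounded_bilinear.comp[OF bounded_bilinear_inner blJ]
          bounded_linear_compose[OF matrix_vector_mul_bounded_linear blJ])
    show "V x y = V y x" for x y
      unfolding V_def using Q(2) by (metis dot_lmul_matrix inner_commute transpose_matrix_vector)
    show "2 * V z (T z) \<ge> 2 * \<beta> * V z z + 1 * (norm z)\<^sup>2" for z
      using Q(3)[of "J z"] unfolding V_def M inner_J by (simp add: power2_norm_eq_inner)
    show "0 < V (J' u) (J' u)" using Q(4) by (simp add: V_def JJ')
  qed (use Q(1) in auto)
qed

lemma linear_loop_instability:
  assumes mode: "loop_mode G \<Delta> s (of_real k) x y w" "x \<noteq> 0 \<or> y \<noteq> 0 \<or> w \<noteq> 0" "0 < Re s"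
    and wp: "lin_well_posed G (scale_lti k \<Delta>)"
    and F: "F 0 = 0" "0 < r" "L-lipschitz_on (cball 0 r) F"
      "(F has_derivative lin_closed_loop G (scale_lti k \<Delta>)) (at 0)"
  shows "\<not> lyapunov_stable F 0"
  using linearized_instability[OF F loop_mode_real_eigenplane[OF mode(1,2) wp] mode(3)] .

section \<open>The nonlinear feedback loop near the origin\<close>

lemma C1_on_locally_lipschitz:
  assumes C1: "C1_on h U" and U: "open U" "z0 \<in> U"
  obtains r L where "0 < r" "L-lipschitz_on (cball z0 r) h"
proof -
  obtain h' where h': "\<And>z. z \<in> U \<Longrightarrow> (h has_derivative blinfun_apply (h' z)) (at z)"
    and cont: "continuous_on U h'"
    using C1 unfolding C1_on_def by blast
  have "\<forall>\<^sub>F z in at z0. dist (h' z) (h' z0) < 1"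
    using cont U by (simp add: continuous_on_eq_continuous_at isCont_def tendstoD)
  then obtain d where "0 < d" and d': "\<And>z. z \<noteq> z0 \<Longrightarrow> dist z z0 < d \<Longrightarrow> dist (h' z) (h' z0) < 1"
    unfolding eventually_at by blast
  then have d: "0 < d" "\<And>z. dist z z0 < d \<Longrightarrow> dist (h' z) (h' z0) < 1"
    using dist_self zero_less_one by metis+
  obtain e where e: "0 < e" "cball z0 e \<subseteq> U" using U open_contains_cball by blast
  define r where "r = min e (d / 2)"
  have r: "0 < r" "cball z0 r \<subseteq> U" "r < d" using d(1) e by (auto simp: r_def)
  define L where "L = norm (h' z0) + 1"
  have "L-lipschitz_on (cball z0 r) h"
  proof (rule lipschitz_onI)
    fix x y assume xy: "x \<in> cball z0 r" "y \<in> cball z0 r"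
    have "norm (h x - h y) \<le> L * norm (x - y)"
    proof (rule differentiable_bound[OF convex_cball _ _ xy])
      fix z assume z: "z \<in> cball z0 r"
      then show "(h has_derivative blinfun_apply (h' z)) (at z within cball z0 r)"
        using h' r(2) has_derivative_at_withinI by blast
      have "norm (h' z) \<le> norm (h' z0) + norm (h' z - h' z0)" by (rule norm_triangle_sub)
      also have "norm (h' z - h' z0) < 1"
        using d(2)[of z] z r(3) by (simp add: dist_norm norm_minus_commute)
      finally show "onorm (blinfun_apply (h' z)) \<le> L" by (simp add: L_def norm_blinfun.rep_eq)
    qed
    then show "dist (h x) (h y) \<le> L * dist x y" by (simp add: dist_norm)
  qed (simp add: L_def)
  then show ?thesis using that r(1) by blast
qed

text \<open>A single estimate carries everything: comparing the fixed-point equations at two states and absorbing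
  \<open>q |W z - W z'|\<close> on the left. Against the state 0 it first gives the linear bound that keeps the points \<open>(x, W z)\<close> in the
  ball where \<open>g\<close> is Lipschitz, and then the Lipschitz bound for any two states.\<close>

lemma implicit_input_lipschitz:
  fixes g :: "(real^'n) \<times> (real^'m) \<Rightarrow> real^'p" and W :: "(real^'n) \<times> (real^'k) \<Rightarrow> real^'m"
  assumes W: "\<And>z. W z = C' *v snd z + D' *v g (fst z, W z)"
    and contr: "\<And>x w w'. norm (D' *v g (x, w) - D' *v g (x, w')) \<le> q * norm (w - w')" and q: "q < 1"
    and r: "0 < r" and lip: "L-lipschitz_on (cball 0 r) g" and g0: "g (0, 0) = 0"
  obtains K \<delta> where "0 < \<delta>" "K-lipschitz_on (cball 0 \<delta>) W" "W 0 = 0"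
    "\<And>z. z \<in> cball 0 \<delta> \<Longrightarrow> (fst z, W z) \<in> cball 0 r"
proof -
  obtain c where c: "0 < c" "\<And>y. norm (C' *v y) \<le> norm y * c"
    using bounded_linear.pos_bounded[OF matrix_vector_mul_bounded_linear[of C']] by blast
  obtain d where d: "0 < d" "\<And>v. norm (D' *v v) \<le> norm v * d"
    using bounded_linear.pos_bounded[OF matrix_vector_mul_bounded_linear[of D']] by blast
  have L: "0 \<le> L" using lip by (rule lipschitz_on_nonneg)
  define K where "K = (c + d * L) / (1 - q)"
  have K: "0 \<le> K" using c(1) d(1) L q by (simp add: K_def)
  have estimate: "norm (W z - W z') \<le> K * norm (z - z')"
    if "(fst z, W z) \<in> cball 0 r" "(fst z', W z) \<in> cball 0 r" for z z'
  proof -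
    have "W z - W z' = C' *v (snd z - snd z') + D' *v (g (fst z, W z) - g (fst z', W z))
        + (D' *v g (fst z', W z) - D' *v g (fst z', W z'))"
      by (subst W, subst (2) W) (simp add: matrix_vector_mult_diff_distrib)
    then have "norm (W z - W z') \<le> norm (C' *v (snd z - snd z')) + norm (D' *v (g (fst z, W z) - g (fst z', W z)))
        + norm (D' *v g (fst z', W z) - D' *v g (fst z', W z'))"
      by (smt (verit, best) norm_triangle_ineq)
    also have "norm (C' *v (snd z - snd z')) \<le> c * norm (z - z')"
    proof -
      have "norm (snd z - snd z') \<le> norm (z - z')"
        using dist_snd_le[of z z'] by (simp add: dist_norm)
      then have "norm (snd z - snd z') * c \<le> norm (z - z') * c" using c(1) by simp
      then show ?thesis using c(2)[of "snd z - snd z'"] by (simp add: mult.commute)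
    qed
    also have "norm (D' *v (g (fst z, W z) - g (fst z', W z))) \<le> d * L * norm (z - z')"
    proof -
      have "norm (g (fst z, W z) - g (fst z', W z)) \<le> L * norm (fst z - fst z')"
        using lipschitz_onD[OF lip that] by (simp add: dist_norm dist_Pair_Pair)
      also have "\<dots> \<le> L * norm (z - z')"
        using dist_fst_le[of z z'] L by (intro mult_left_mono) (auto simp: dist_norm)
      finally show ?thesis using d by (smt (verit) mult.assoc mult.commute mult_left_mono)
    qed
    also have "norm (D' *v g (fst z', W z) - D' *v g (fst z', W z')) \<le> q * norm (W z - W z')" by (rule contr)
    finally have "(1 - q) * norm (W z - W z') \<le> (c + d * L) * norm (z - z')" by (simp add: algebra_simps)
    then show ?thesis using q by (simp add: K_def field_simps)
  qed
  have W0: "W 0 = 0"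
  proof (rule ccontr)
    assume "W 0 \<noteq> 0"
    have "norm (W 0) \<le> q * norm (W 0)"
      using contr[of 0 "W 0" 0] W[of 0] g0 by simp
    then show False using \<open>W 0 \<noteq> 0\<close> q by simp
  qed
  have bound: "norm (W z) \<le> K * norm z" if "norm z \<le> r" for z
  proof -
    have "norm (fst z) \<le> r" using norm_fst_le[of "fst z" "snd z"] that by simp
    then show ?thesis using estimate[of 0 z] r W0 by simp
  qed
  define \<delta> where "\<delta> = r / (1 + K)"
  have "(1 + K) * \<delta> = r" using K by (simp add: \<delta>_def)
  then have \<delta>: "0 < \<delta>" "\<delta> + K * \<delta> = r"
    using r K by (simp add: \<delta>_def, simp add: distrib_right)
  then have "\<delta> \<le> r" using K by (smt (verit) mult_nonneg_nonneg)
  have inside: "(fst z', W z) \<in> cball 0 r" if "z \<in> cball 0 \<delta>" "z' \<in> cball 0 \<delta>"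
    for z z' :: "(real^'n) \<times> (real^'k)"
  proof -
    have "norm (fst z', W z) \<le> norm (fst z') + norm (W z)" by (rule norm_Pair_le)
    also have "norm (fst z') \<le> \<delta>" using norm_fst_le[of "fst z'" "snd z'"] that(2) by simp
    also have "norm (W z) \<le> K * \<delta>"
      using bound[of z] that(1) \<open>\<delta> \<le> r\<close> K by (smt (verit) mem_cball_0 mult_left_mono)
    finally show ?thesis using \<delta>(2) by simp
  qed
  show ?thesis
  proof (rule that[OF \<delta>(1) _ W0])
    show "K-lipschitz_on (cball 0 \<delta>) W"
      using estimate inside K by (intro lipschitz_onI) (auto simp: dist_norm)
  qed (use inside in blast)
qed

text \<open>The linearized equation holds for \<open>W\<close> up to \<open>D' \<rho>(x, W z)\<close>, where \<open>\<rho>\<close> is the Taylor remainder of \<open>g\<close>. It is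
  \<open>o(|z|)\<close> since \<open>W\<close> is Lipschitz, and inverting \<open>I - D' D\<close> keeps it so.\<close>

lemma implicit_input_has_derivative:
  fixes g :: "(real^'n) \<times> (real^'m) \<Rightarrow> real^'p" and W :: "(real^'n) \<times> (real^'k) \<Rightarrow> real^'m"
  assumes W: "\<And>z. W z = C' *v snd z + D' *v g (fst z, W z)"
    and lip: "K-lipschitz_on (cball 0 \<delta>) W" "0 < \<delta>" and W0: "W 0 = 0" and g0: "g (0, 0) = 0"
    and der: "(g has_derivative (\<lambda>u. C *v fst u + D *v snd u)) (at (0, 0))"
    and inv: "invertible (mat 1 - D' ** D)"
  shows "(W has_derivative (\<lambda>z. matrix_inv (mat 1 - D' ** D) *v (D' *v (C *v fst z) + C' *v snd z))) (at 0)"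
proof -
  let ?N = "matrix_inv (mat 1 - D' ** D)"
  define W' where "W' z = ?N *v (D' *v (C *v fst z) + C' *v snd z)" for z
  define \<rho> where "\<rho> u = g u - (C *v fst u + D *v snd u)" for u
  have "g 0 = 0" using g0 by (simp add: zero_prod_def)
  then have \<rho>_small: "\<forall>e>0. \<exists>d>0. \<forall>u. norm u < d \<longrightarrow> norm (\<rho> u) \<le> e * norm u"
    using der[folded zero_prod_def] unfolding has_derivative_at_alt \<rho>_def by simp
  define N' where "N' v = ?N *v (D' *v v)" for v
  have N'_lin: "bounded_linear N'"
    unfolding N'_def by (intro bounded_linear_compose[OF matrix_vector_mul_bounded_linear] matrix_vector_mul_bounded_linear)
  obtain n where n: "0 < n" "\<And>v. norm (N' v) \<le> norm v * n"
    using bounded_linear.pos_bounded[OF N'_lin] by blast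
  have K: "0 \<le> K" using lip(1) by (rule lipschitz_on_nonneg)
  have W'_lin: "bounded_linear W'"
    unfolding W'_def
    by (intro bounded_linear_compose[OF matrix_vector_mul_bounded_linear] bounded_linear_add
        bounded_linear_fst bounded_linear_snd)
  have residual: "W z - W' z = N' (\<rho> (fst z, W z))" for z
  proof -
    have "W z - D' *v (D *v W z) = D' *v (C *v fst z) + C' *v snd z + D' *v \<rho> (fst z, W z)"
      by (subst (1) W) (simp add: \<rho>_def matrix_vector_mult_diff_distrib matrix_vector_right_distrib)
    then have "(mat 1 - D' ** D) *v W z = D' *v (C *v fst z) + C' *v snd z + D' *v \<rho> (fst z, W z)"
      by (simp add: matrix_vector_mult_diff_rdistrib matrix_vector_mul_assoc[symmetric])
    then have "W z = ?N *v (D' *v (C *v fst z) + C' *v snd z + D' *v \<rho> (fst z, W z))"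
      using matrix_inv_mult_vec(2)[OF inv, of "W z"] by simp
    then have "W z = W' z + N' (\<rho> (fst z, W z))" by (simp add: W'_def N'_def matrix_vector_right_distrib)
    then show ?thesis unfolding diff_eq_eq by (simp only: add.commute)
  qed
  have "\<exists>d>0. \<forall>z. norm z < d \<longrightarrow> norm (W z - W' z) \<le> e * norm z" if e: "0 < e" for e
  proof -
    have "0 < e / (n * (1 + K))" using e n(1) K by simp
    then obtain d where d: "0 < d" "\<And>u. norm u < d \<Longrightarrow> norm (\<rho> u) \<le> e / (n * (1 + K)) * norm u"
      using \<rho>_small by blast
    define d' where "d' = min \<delta> (d / (1 + K))"
    have "0 < d'" using d(1) lip(2) K by (simp add: d'_def)
    moreover have "norm (W z - W' z) \<le> e * norm z" if z: "norm z < d'" for z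
    proof -
      have "norm (W z) \<le> K * norm z"
        using lipschitz_onD[OF lip(1), of z 0] z lip(2) W0 by (simp add: d'_def)
      moreover have "norm (fst z) \<le> norm z" using norm_fst_le[of "fst z" "snd z"] by simp
      ultimately have u: "norm (fst z, W z) \<le> (1 + K) * norm z"
        using norm_Pair_le[of "fst z" "W z"] by (simp add: algebra_simps)
      also have "\<dots> < d" using z K by (simp add: d'_def field_simps)
      finally have "norm (\<rho> (fst z, W z)) \<le> e / (n * (1 + K)) * norm (fst z, W z)" by (rule d(2))
      also have "\<dots> \<le> e / (n * (1 + K)) * ((1 + K) * norm z)"
        using u e n(1) K by (intro mult_left_mono) auto
      also have "\<dots> = e / n * norm z"
        using nonzero_mult_divide_mult_cancel_right[of "1 + K" "e * norm z" n] K by (simp add: mult_ac)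
      finally have "norm (\<rho> (fst z, W z)) * n \<le> e / n * norm z * n"
        using n(1) by (intro mult_right_mono) auto
      then show ?thesis unfolding residual using n(2)[of "\<rho> (fst z, W z)"] n(1) by simp
    qed
    ultimately show ?thesis by blast
  qed
  then show ?thesis
    unfolding has_derivative_at_alt W'_def[symmetric] using W'_lin W0 bounded_linear.linear[OF W'_lin] linear_0
    by auto
qed

lemma has_derivative_partials:
  assumes g': "(g has_derivative g') (at (x, w))"
  shows "((\<lambda>x. g (x, w)) has_derivative (\<lambda>v. g' (v, 0))) (at x)"
    and "((\<lambda>w. g (x, w)) has_derivative (\<lambda>v. g' (0, v))) (at w)"
  by (rule has_derivative_compose[of "\<lambda>x. (x, w)" "\<lambda>v. (v, 0)", OF _ g'], auto intro!: derivative_eq_intros)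
     (rule has_derivative_compose[of "\<lambda>w. (x, w)" "\<lambda>v. (0, v)", OF _ g'], auto intro!: derivative_eq_intros)

lemma has_derivative_jac_w:
  assumes "(g has_derivative g') (at (x, w))"
  shows "((\<lambda>w. g (x, w)) has_derivative (\<lambda>v. jac_w g x w *v v)) (at w)"
  using has_derivative_partials(2)[OF assms] unfolding jac_w_def
  by (metis differentiable_def jacobian_works)

lemma has_derivative_jacobian_blocks:
  assumes g': "(g has_derivative g') (at (x, w))"
  shows "(g has_derivative (\<lambda>u. jac_x g x w *v fst u + jac_w g x w *v snd u)) (at (x, w))"
proof -
  have w: "g' (0, v) = jac_w g x w *v v" for v
    using has_derivative_unique[OF has_derivative_partials(2)[OF g'] has_derivative_jac_w[OF g']]
    by (rule fun_cong)
  have dx: "((\<lambda>x. g (x, w)) has_derivative (\<lambda>v. jac_x g x w *v v)) (at x)"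
    using has_derivative_partials(1)[OF g'] unfolding jac_x_def
    by (metis differentiable_def jacobian_works)
  have x: "g' (v, 0) = jac_x g x w *v v" for v
    by (rule fun_cong[OF has_derivative_unique[OF has_derivative_partials(1)[OF g'] dx]])
  have "g' u = jac_x g x w *v fst u + jac_w g x w *v snd u" for u
    using linear_add[OF has_derivative_linear[OF g'], of "(fst u, 0)" "(0, snd u)"] by (simp add: x w)
  then have "g' = (\<lambda>u. jac_x g x w *v fst u + jac_w g x w *v snd u)" by (rule ext)
  then show ?thesis using g' by simp
qed

text \<open>Both alternatives of the standing assumption say that \<open>D' \<partial>\<^sub>w g\<close> is bounded by some \<open>q < 1\<close>, a condition that
  survives a small scaling of \<open>D'\<close>.\<close>

lemma standing_well_posedness_contraction:
  fixes g :: "(real^'n) \<times> (real^'m) \<Rightarrow> real^'p" and \<Delta> :: "('k::finite, 'p, 'm) lti"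
  assumes "standing_well_posedness f g \<Delta>"
  obtains q where "0 \<le> q" "q < 1" "\<And>x w v. norm (lti_D \<Delta> *v (jac_w g x w *v v)) \<le> q * norm v"
proof (cases "lti_D \<Delta> = 0")
  case True
  then show ?thesis using that[of 0] by simp
next
  case False
  let ?S = "SUP (x, w)\<in>UNIV. ereal (spectral_norm (lti_D \<Delta> ** jac_w g x w))"
  have "?S < 1" using assms False by (simp add: standing_well_posedness_def)
  then obtain q' where q': "?S < ereal q'" "ereal q' < 1" using ereal_dense2 by blast
  have le: "spectral_norm (lti_D \<Delta> ** jac_w g x w) \<le> q'" for x w
  proof -
    have "ereal (spectral_norm (lti_D \<Delta> ** jac_w g x w)) \<le> ?S"
      by (rule SUP_upper2[of "(x, w)"]) auto
    from le_less_trans[OF this q'(1)] show ?thesis by simp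
  qed
  have "norm (lti_D \<Delta> *v (jac_w g x w *v v)) \<le> max q' 0 * norm v" for x w v
  proof -
    have "norm ((lti_D \<Delta> ** jac_w g x w) *v v) \<le> spectral_norm (lti_D \<Delta> ** jac_w g x w) * norm v"
      unfolding spectral_norm_def by (rule onorm) (rule matrix_vector_mul_bounded_linear)
    also have "\<dots> \<le> max q' 0 * norm v" using le[of x w] by (intro mult_right_mono) auto
    finally show ?thesis by (simp add: matrix_vector_mul_assoc)
  qed
  moreover have "max q' 0 < 1" using q'(2) by simp
  ultimately show ?thesis using that[of "max q' 0"] by simp
qed

text \<open>The loop vector field is built from \<open>f\<close> and \<open>g\<close> after the map \<open>z \<mapsto> (x, W z)\<close>, so it is as regular as the implicit
  input \<open>W\<close>, and the chain rule with the derivative of \<open>W\<close> produces the linear loop.\<close>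

lemma nonlinear_loop_regular:
  fixes f :: "(real^'n) \<times> (real^'m) \<Rightarrow> real^'n"
    and g :: "(real^'n) \<times> (real^'m) \<Rightarrow> real^'p"
    and \<Delta> :: "('k::finite, 'p, 'm) lti"
  assumes f0: "f (0, 0) = 0" and g0: "g (0, 0) = 0"
    and f: "open U" "(0, 0) \<in> U" "C1_on f U" and g: "C1_on g UNIV"
    and q: "q < 1" "\<And>x w v. norm (lti_D \<Delta> *v (jac_w g x w *v v)) \<le> q * norm v"
  shows "nl_well_posed g \<Delta>" "lin_well_posed (linearization f g) \<Delta>" "nl_closed_loop f g \<Delta> 0 = 0"
    "\<exists>r>0. \<exists>L. L-lipschitz_on (cball 0 r) (nl_closed_loop f g \<Delta>)"
    "(nl_closed_loop f g \<Delta> has_derivative lin_closed_loop (linearization f g) \<Delta>) (at 0)"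
proof -
  let ?A = "lti_A \<Delta>" and ?B = "lti_B \<Delta>" and ?C = "lti_C \<Delta>" and ?D = "lti_D \<Delta>"
  have contr: "norm (?D *v g (x, w) - ?D *v g (x, w')) \<le> max q 0 * norm (w - w')" for x w w'
  proof (rule differentiable_bound[where S=UNIV and f'="\<lambda>w v. ?D *v (jac_w g x w *v v)"])
    show "((\<lambda>w. ?D *v g (x, w)) has_derivative (\<lambda>v. ?D *v (jac_w g x w *v v))) (at w within UNIV)" for w
    proof -
      obtain g' where "(g has_derivative g') (at (x, w))" using g unfolding C1_on_def by blast
      from bounded_linear.has_derivative[OF matrix_vector_mul_bounded_linear[of ?D] has_derivative_jac_w[OF this]]
      show ?thesis by simp
    qed
    show "onorm (\<lambda>v. ?D *v (jac_w g x w *v v)) \<le> max q 0" for w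
      using q(2) by (intro onorm_le) (meson max.cobounded1 mult_right_mono norm_ge_zero order_trans)
  qed auto
  have q1: "max q 0 < 1" using q(1) by simp
  have invertible: "invertible (mat 1 - ?D ** jac_w g x w)" for x w
  proof -
    have "v = 0" if "(mat 1 - ?D ** jac_w g x w) *v v = 0" for v
    proof (rule ccontr)
      assume "v \<noteq> 0"
      have "v = ?D *v (jac_w g x w *v v)"
        using that by (simp add: matrix_vector_mult_diff_rdistrib matrix_vector_mul_assoc)
      then have "norm v \<le> q * norm v" using q(2)[of x w v] by simp
      then show False using q(1) \<open>v \<noteq> 0\<close> by simp
    qed
    then show ?thesis by (simp add: invertible_iff_kernel)
  qed
  have unique: "\<exists>!w. w = ?C *v y + ?D *v g (x, w)" for x y
  proof -
    have "\<exists>!w. ?C *v y + ?D *v g (x, w) = w"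
      by (rule banach_fix_type[OF _ q1]) (use contr in \<open>auto simp: dist_norm\<close>)
    then show ?thesis by (metis (no_types))
  qed
  show nl: "nl_well_posed g \<Delta>" using invertible unique by (simp add: nl_well_posed_def)
  show "lin_well_posed (linearization f g) \<Delta>"
    using invertible[of 0 0] by (simp add: lin_well_posed_def linearization_def invertible_det_nz)
  define W where "W z = (THE w. w = ?C *v snd z + ?D *v g (fst z, w))" for z
  have W: "W z = ?C *v snd z + ?D *v g (fst z, W z)" for z
    unfolding W_def by (rule theI'[OF unique])
  have loop: "nl_closed_loop f g \<Delta> = (\<lambda>z. (f (fst z, W z), ?A *v snd z + ?B *v g (fst z, W z)))"
    by (auto simp: nl_closed_loop_def W_def Let_def)
  obtain rf Lf where rf: "0 < rf" "Lf-lipschitz_on (cball (0, 0) rf) f"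
    using C1_on_locally_lipschitz[OF f(3,1,2)] by blast
  obtain rg Lg where rg: "0 < rg" "Lg-lipschitz_on (cball (0, 0) rg) g"
    using C1_on_locally_lipschitz[OF g open_UNIV UNIV_I] by blast
  define r where "r = min rf rg"
  have r: "0 < r" "Lf-lipschitz_on (cball 0 r) f" "Lg-lipschitz_on (cball 0 r) g"
    using rf rg by (auto simp: r_def zero_prod_def intro: lipschitz_on_subset)
  obtain K \<delta> where \<delta>: "0 < \<delta>" "K-lipschitz_on (cball 0 \<delta>) W" "W 0 = 0"
    "\<And>z. z \<in> cball 0 \<delta> \<Longrightarrow> (fst z, W z) \<in> cball 0 r"
    by (rule implicit_input_lipschitz[OF W contr q1 r(1,3) g0]) (rule that)
  show "nl_closed_loop f g \<Delta> 0 = 0" by (simp add: loop \<delta>(3) f0 g0 prod_eq_iff)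
  have H_lip: "(sqrt (1\<^sup>2 + K\<^sup>2))-lipschitz_on (cball 0 \<delta>) (\<lambda>z. (fst z, W z))"
    by (intro lipschitz_on_Pair \<delta>(2) lipschitz_onI) (auto simp: dist_fst_le)
  have lin_lip: "\<exists>L. L-lipschitz_on X (\<lambda>z. M *v z)" for X and M :: "real^'x^'y"
    using bounded_linear.lipschitz_boundE[OF matrix_vector_mul_bounded_linear] by blast
  have H_img: "(\<lambda>z. (fst z, W z)) ` cball 0 \<delta> \<subseteq> cball 0 r" using \<delta>(4) by blast
  have f_lip: "(Lf * sqrt (1\<^sup>2 + K\<^sup>2))-lipschitz_on (cball 0 \<delta>) (\<lambda>z. f (fst z, W z))"
    by (rule lipschitz_on_compose2[OF H_lip lipschitz_on_subset[OF r(2) H_img]])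
  have g_lip: "(Lg * sqrt (1\<^sup>2 + K\<^sup>2))-lipschitz_on (cball 0 \<delta>) (\<lambda>z. g (fst z, W z))"
    by (rule lipschitz_on_compose2[OF H_lip lipschitz_on_subset[OF r(3) H_img]])
  obtain LA where LA: "LA-lipschitz_on UNIV (\<lambda>y. ?A *v y)" using lin_lip by blast
  obtain LB where LB: "LB-lipschitz_on UNIV (\<lambda>v. ?B *v v)" using lin_lip by blast
  have snd_lip: "1-lipschitz_on (cball 0 \<delta>) snd"
    by (intro lipschitz_onI) (auto simp: dist_snd_le)
  have "(sqrt ((Lf * sqrt (1\<^sup>2 + K\<^sup>2))\<^sup>2 + (LA * 1 + LB * (Lg * sqrt (1\<^sup>2 + K\<^sup>2)))\<^sup>2))-lipschitz_on (cball 0 \<delta>) (nl_closed_loop f g \<Delta>)"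
    unfolding loop
    by (intro lipschitz_on_Pair f_lip lipschitz_on_add lipschitz_on_compose2[OF snd_lip]
        lipschitz_on_compose2[OF g_lip] lipschitz_on_subset[OF LA] lipschitz_on_subset[OF LB]) auto
  then show "\<exists>r>0. \<exists>L. L-lipschitz_on (cball 0 r) (nl_closed_loop f g \<Delta>)" using \<delta>(1) by blast
  obtain f' where "(f has_derivative f') (at (0, 0))" using f unfolding C1_on_def by blast
  then have df: "(f has_derivative (\<lambda>u. jac_x f 0 0 *v fst u + jac_w f 0 0 *v snd u)) (at (0, 0))"
    by (rule has_derivative_jacobian_blocks)
  obtain g' where "(g has_derivative g') (at (0, 0))" using g unfolding C1_on_def by blast
  then have dg: "(g has_derivative (\<lambda>u. jac_x g 0 0 *v fst u + jac_w g 0 0 *v snd u)) (at (0, 0))"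
    by (rule has_derivative_jacobian_blocks)
  define W' where "W' z = matrix_inv (mat 1 - ?D ** jac_w g 0 0) *v (?D *v (jac_x g 0 0 *v fst z) + ?C *v snd z)" for z
  have dW: "(W has_derivative W') (at 0)"
    unfolding W'_def by (rule implicit_input_has_derivative[OF W \<delta>(2,1,3) g0 dg invertible])
  have dH: "((\<lambda>z. (fst z, W z)) has_derivative (\<lambda>z. (fst z, W' z))) (at 0)"
    by (intro has_derivative_Pair has_derivative_fst has_derivative_ident dW)
  have dHf: "((\<lambda>z. f (fst z, W z)) has_derivative (\<lambda>z. jac_x f 0 0 *v fst z + jac_w f 0 0 *v W' z)) (at 0)"
    using has_derivative_compose[OF dH, of f, simplified \<delta>(3) fst_zero, OF df] by simp
  have dHg: "((\<lambda>z. g (fst z, W z)) has_derivative (\<lambda>z. jac_x g 0 0 *v fst z + jac_w g 0 0 *v W' z)) (at 0)"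
    using has_derivative_compose[OF dH, of g, simplified \<delta>(3) fst_zero, OF dg] by simp
  have "(nl_closed_loop f g \<Delta> has_derivative (\<lambda>z. (jac_x f 0 0 *v fst z + jac_w f 0 0 *v W' z,
      ?A *v snd z + ?B *v (jac_x g 0 0 *v fst z + jac_w g 0 0 *v W' z)))) (at 0)"
    unfolding loop
    by (intro has_derivative_Pair has_derivative_add dHf
        bounded_linear.has_derivative[OF matrix_vector_mul_bounded_linear]
        has_derivative_snd has_derivative_ident dHg)
  moreover have "lin_closed_loop (linearization f g) \<Delta> = (\<lambda>z. (jac_x f 0 0 *v fst z + jac_w f 0 0 *v W' z,
      ?A *v snd z + ?B *v (jac_x g 0 0 *v fst z + jac_w g 0 0 *v W' z)))"
    by (auto simp: lin_closed_loop_def linearization_def W'_def Let_def)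
  ultimately show "(nl_closed_loop f g \<Delta> has_derivative lin_closed_loop (linearization f g) \<Delta>) (at 0)"
    by simp
qed

section \<open>Instability of the attacked loops\<close>

theorem corollary1:
  fixes f :: "(real^'n) \<times> (real^'m) \<Rightarrow> real^'n"
    and g :: "(real^'n) \<times> (real^'m) \<Rightarrow> real^'p"
    and \<Delta> :: "('k::finite, 'p, 'm) lti"
  assumes "exposed_system f g"
    and "stable_lti (linearization f g)"
    and "transfer_nonzero (linearization f g)"
    and "standing_well_posedness f g \<Delta>"
    and "minimal_destabilizing_attack (linearization f g) \<Delta>"
  shows "(\<forall>\<^sub>F \<epsilon> in at_right (0::real).
            lin_well_posed (linearization f g) (scale_lti (1 + \<epsilon>) \<Delta>) \<and>
            \<not> internally_stable (linearization f g) (scale_lti (1 + \<epsilon>) \<Delta>)) \<and>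
         (\<forall>\<^sub>F \<epsilon> in at_right (0::real).
            nl_well_posed g (scale_lti (1 + \<epsilon>) \<Delta>) \<and>
            unstable_equilibrium (nl_closed_loop f g (scale_lti (1 + \<epsilon>) \<Delta>)) 0)"
proof -
  let ?G = "linearization f g" and ?\<Delta> = "\<lambda>\<epsilon>. scale_lti (1 + \<epsilon>) \<Delta>"
  have f0: "f (0, 0) = 0" and g0: "g (0, 0) = 0" and g: "C1_on g UNIV"
    using assms(1) by (auto simp: exposed_system_def)
  obtain U where U: "open U" "(0, 0) \<in> U" "C1_on f U"
    using assms(1) unfolding exposed_system_def by blast
  obtain q where q: "0 \<le> q" "q < 1" "\<And>x w v. norm (lti_D \<Delta> *v (jac_w g x w *v v)) \<le> q * norm v"
    using standing_well_posedness_contraction[OF assms(4)] by blast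
  have "lin_well_posed ?G \<Delta>" using assms(4) by (simp add: lin_well_posed_def standing_well_posedness_def)
  note modes = unstable_loop_modes[OF assms(2,5) this]
  have "((\<lambda>\<epsilon>. (1 + \<epsilon>) * q) \<longlongrightarrow> (1 + 0) * q) (at_right (0::real))" by (intro tendsto_intros)
  then have "\<forall>\<^sub>F \<epsilon> in at_right (0::real). (1 + \<epsilon>) * q < 1" using q(2) by (intro order_tendstoD) auto
  moreover have "\<forall>\<^sub>F \<epsilon> in at_right (0::real). 0 < \<epsilon>" by (rule eventually_at_right_less)
  ultimately have "\<forall>\<^sub>F \<epsilon> in at_right (0::real).
      (lin_well_posed ?G (?\<Delta> \<epsilon>) \<and> \<not> internally_stable ?G (?\<Delta> \<epsilon>)) \<and>
      (nl_well_posed g (?\<Delta> \<epsilon>) \<and> unstable_equilibrium (nl_closed_loop f g (?\<Delta> \<epsilon>)) 0)"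
    using modes
  proof eventually_elim
    case (elim \<epsilon>)
    obtain s x y w where mode: "loop_mode ?G \<Delta> s (of_real (1 + \<epsilon>)) x y w"
        "x \<noteq> 0 \<or> y \<noteq> 0 \<or> w \<noteq> 0" "0 < Re s"
      using elim(3) by blast
    have "norm (lti_D (?\<Delta> \<epsilon>) *v (jac_w g x w *v v)) \<le> (1 + \<epsilon>) * q * norm v" for x w v
      using q(3)[of x w v] elim(2) by (simp add: scaleR_matrix_vector_assoc[symmetric] mult.assoc mult_left_mono)
    note regular = nonlinear_loop_regular[OF f0 g0 U g elim(1) this]
    obtain r L where rL: "0 < r" "L-lipschitz_on (cball 0 r) (nl_closed_loop f g (?\<Delta> \<epsilon>))"
      using regular(4) by blast
    let ?T = "lin_closed_loop ?G (?\<Delta> \<epsilon>)"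
    have T: "bounded_linear ?T" by (rule bounded_linear_lin_closed_loop)
    obtain LT where LT: "LT-lipschitz_on (cball 0 1) ?T"
      using bounded_linear.lipschitz_boundE[OF T] by blast
    have "\<not> lyapunov_stable ?T 0"
      by (rule linear_loop_instability[OF mode regular(2) _ _ LT bounded_linear_imp_has_derivative[OF T]])
         (simp_all add: bounded_linear.linear[OF T] linear_0)
    moreover have "\<not> lyapunov_stable (nl_closed_loop f g (?\<Delta> \<epsilon>)) 0"
      by (rule linear_loop_instability[OF mode regular(2,3) rL regular(5)])
    ultimately show ?case
      using regular(1,2,3)
      by (simp add: internally_stable_def asymptotically_stable_def unstable_equilibrium_def equilibrium_def)
  qed
  then show ?thesis by (simp add: eventually_conj_iff)
qed

end
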